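(* Let $E=K(n,m,\mathcal D)$ be a Bedford-McMullen carpet of non-doubling type and assume that $a_0>a_{m-1}$. Let $\delta=\delta_\varphi$ be the doubling index with respect to the gauge function $\varphi(r)=-\log r$. Then for $\mu_E$-a.e. $z\in E$ the doubling index $\delta(z;\mu_E)$ exists and equals $0$, and the range $\{\overline\delta(z;\mu_E):z\in E\}$ is the interval $[0,\delta_{\max}]$, where $$\delta_{\max}=(\log n)^{-1}(1/\sigma-1)\log(a_0/a_{m-1}).$$
   Context: Let $n>m\ge 2$ be integers, $\sigma=\log m/\log n$, and let $\mathcal D\subset\{0,\dots,n-1\}\times\{0,\dots,m-1\}$ be nonempty. For $\mathbf d\in\mathcal D$ let $S_{\mathbf d}(z)=\mathrm{diag}(n^{-1},m^{-1})(z+\mathbf d)$ on $\mathbb R^2$. The Bedford-McMullen carpet $E=K(n,m,\mathcal D)$ is the unique nonempty compact set with $E=\bigcup_{\mathbf d\in\mathcal D}S_{\mathbf d}(E)$, a metric space with the Euclidean distance. Its uniform Bernoulli measure $\mu_E$ is the unique Borel probability measure supported on $E$ with $\mu_E=\frac1{\#\mathcal D}\sum_{\mathbf d\in\mathcal D}\mu_E\circ S_{\mathbf d}^{-1}$. The fiber sequence is $a_j=\#\{i:(i,j)\in\mathcal D\}$, $0\le j\le m-1$. $B_r(x)$ denotes the open ball. A Borel probability measure $\mu$ is doubling if $\sup_{x\in\mathrm{supp}\,\mu,\ r>0}\mu(B_{2r}(x))/\mu(B_r(x))<\infty$. $E$ is of non-doubling type if $\mu_E$ is not doubling. (Known, due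 to Li-Wei-Wen: this holds if and only if $a_0a_{m-1}>0$, $a_0\ne a_{m-1}$, and $a_ja_{j+1}>0$ for some $0\le j\le m-2$.) For a measure $\mu$ on a metric space $X$ (here $X=E$), $0<\rho<1$ and $z\in X$, the upper doubling index with respect to $\varphi(r)=-\log r$ is $$\overline\delta(z;\mu,\rho)=\limsup_{r\to0}\ \sup_{z'\in X:\ B_{\rho r}(z')\subset B_r(z)}\frac{\log[\mu(B_r(z))/\mu(B_{\rho r}(z'))]}{-\log r},$$ and the lower doubling index $\underline\delta(z;\mu,\rho)$ is obtained by replacing $\limsup$ by $\liminf$; if they agree the common value is $\delta(z;\mu,\rho)$. For $\mu=\mu_E$ as in the claim these values do not depend on $\rho\in(0,n^{-3})$, and $\rho$ is dropped from the notation; throughout $0<\rho<n^{-3}$. *)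

theory Defs
  imports "HOL-Probability.Probability"
begin

section \<open>Doubling measures and doubling indices\<close>

definition measure_support :: "'a::topological_space measure \<Rightarrow> 'a set" where
  "measure_support M = {x. \<forall>U. open U \<longrightarrow> x \<in> U \<longrightarrow> emeasure M U > 0}"

definition doubling_measure :: "'a::metric_space measure \<Rightarrow> bool" where
  "doubling_measure M \<longleftrightarrow>
     (SUP (x, r) \<in> measure_support M \<times> {0<..}.
        emeasure M (ball x (2 * r)) / emeasure M (ball x r)) < (\<infinity>::ennreal)"

text \<open>
  The metric space is a subset \<open>X\<close> of the ambient type and \<open>M\<close> is a Borel measure on the ambient
  type, so the ball of \<open>X\<close> is \<open>ball z r \<inter> X\<close>. The supremum and the limits are taken in the extended
  reals. The quotient is a real number, so the definitions below are meaningful only when balls of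
  \<open>X\<close> have positive finite measure, i.e.\ when \<open>M\<close> is finite with support \<open>X\<close>.
\<close>

definition doubling_quotient ::
    "(real \<Rightarrow> real) \<Rightarrow> 'a::metric_space set \<Rightarrow> 'a measure \<Rightarrow> real \<Rightarrow> 'a \<Rightarrow> real \<Rightarrow> ereal" where
  "doubling_quotient \<phi> X M \<rho> z r =
     (SUP z' \<in> {z' \<in> X. ball z' (\<rho> * r) \<inter> X \<subseteq> ball z r \<inter> X}.
        ereal (ln (measure M (ball z r \<inter> X) / measure M (ball z' (\<rho> * r) \<inter> X)) / \<phi> r))"

definition upper_doubling_index ::
    "(real \<Rightarrow> real) \<Rightarrow> 'a::metric_space set \<Rightarrow> 'a measure \<Rightarrow> real \<Rightarrow> 'a \<Rightarrow> ereal" where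
  "upper_doubling_index \<phi> X M \<rho> z = Limsup (at_right 0) (doubling_quotient \<phi> X M \<rho> z)"

definition lower_doubling_index ::
    "(real \<Rightarrow> real) \<Rightarrow> 'a::metric_space set \<Rightarrow> 'a measure \<Rightarrow> real \<Rightarrow> 'a \<Rightarrow> ereal" where
  "lower_doubling_index \<phi> X M \<rho> z = Liminf (at_right 0) (doubling_quotient \<phi> X M \<rho> z)"

definition has_doubling_index ::
    "(real \<Rightarrow> real) \<Rightarrow> 'a::metric_space set \<Rightarrow> 'a measure \<Rightarrow> real \<Rightarrow> 'a \<Rightarrow> ereal \<Rightarrow> bool" where
  "has_doubling_index \<phi> X M \<rho> z d \<longleftrightarrow>
     lower_doubling_index \<phi> X M \<rho> z = d \<and> upper_doubling_index \<phi> X M \<rho> z = d"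

section \<open>Bedford-McMullen carpets\<close>

text \<open>The metric of the product type \<^typ>\<open>real \<times> real\<close> is the Euclidean one.\<close>

definition carpet_map :: "nat \<Rightarrow> nat \<Rightarrow> nat \<times> nat \<Rightarrow> real \<times> real \<Rightarrow> real \<times> real" where
  "carpet_map n m d z = ((fst z + real (fst d)) / real n, (snd z + real (snd d)) / real m)"

definition carpet :: "nat \<Rightarrow> nat \<Rightarrow> (nat \<times> nat) set \<Rightarrow> (real \<times> real) set" where
  "carpet n m D = (THE E. E \<noteq> {} \<and> compact E \<and> E = (\<Union>d\<in>D. carpet_map n m d ` E))"

definition carpet_measure :: "nat \<Rightarrow> nat \<Rightarrow> (nat \<times> nat) set \<Rightarrow> (real \<times> real) measure" where
  "carpet_measure n m D = (THE M. sets M = sets borel \<and> prob_space M \<and>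
     emeasure M (- carpet n m D) = 0 \<and>
     (\<forall>A\<in>sets borel. measure M A = 1 / real (card D) * (\<Sum>d\<in>D. measure M (carpet_map n m d -` A))))"

definition fiber_count :: "(nat \<times> nat) set \<Rightarrow> nat \<Rightarrow> nat" where
  "fiber_count D j = card {i. (i, j) \<in> D}"

definition non_doubling_type :: "nat \<Rightarrow> nat \<Rightarrow> (nat \<times> nat) set \<Rightarrow> bool" where
  "non_doubling_type n m D \<longleftrightarrow> \<not> doubling_measure (carpet_measure n m D)"

definition carpet_sigma :: "nat \<Rightarrow> nat \<Rightarrow> real" where
  "carpet_sigma n m = ln (real m) / ln (real n)"

definition delta_max :: "nat \<Rightarrow> nat \<Rightarrow> (nat \<times> nat) set \<Rightarrow> real" where
  "delta_max n m D = inverse (ln (real n)) * (1 / carpet_sigma n m - 1) *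
     ln (real (fiber_count D 0) / real (fiber_count D (m - 1)))"

end

theory Submission
  imports Defs
begin

text \<open>
  Code the points of the carpet by words over \<open>D\<close>. The cylinder fixing the first \<open>k\<close> letters and
  the first \<open>l\<close> row digits, where \<open>n\<^sup>-\<^sup>k\<close> and \<open>m\<^sup>-\<^sup>l\<close> are both comparable to \<open>r\<close> (so that \<open>k \<le> l\<close>), is
  an approximate square of side \<open>r\<close>. Its measure is the product of the fiber counts of the rows
  \<open>k, \<dots>, l - 1\<close> divided by \<open>(card D)\<^sup>l\<close>, and up to constants the measure of a ball of radius \<open>r\<close> is
  the largest weight of an approximate square meeting it. Two vertically adjacent squares have row
  digits \<open>u, j + 1, 0, \<dots>, 0\<close> and \<open>u, j, m - 1, \<dots>, m - 1\<close>, so their weights differ, up to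
  constants, by the power \<open>(a\<^sub>0 / a\<^sub>m\<^sub>-\<^sub>1)\<^sup>s\<close>, where \<open>s\<close> is the number of trailing digits in the window \<open>[k, l)\<close>. Hence the doubling
  index of a point is governed by the lengths of the runs of \<open>0\<close> or \<open>m - 1\<close> in its row digits:
  runs are almost surely short (Borel-Cantelli), never longer than \<open>l - k\<close>, and prescribing
  sparse runs of a fixed relative length produces every value in between.
\<close>

section \<open>Digit expansions\<close>

text \<open>The overview compares two neighbours of a point, whereas the index must be read off from
  the digits of the point itself. The bridge is an integer argument. For points at vertical distance
  about \<open>m ^ (- l)\<close> the integers formed by the first \<open>l - 2\<close> row digits
  differ pairwise by at most 1. If two neighbours have consecutive integers, the integer of the
  centre equals one of them, and so the centre inherits the run of \<open>0\<close> or of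
  \<open>m - 1\<close>. Working with these integers also absorbs the points that have two
  expansions. Orientation matters: since \<open>a_0 > a_(m-1)\<close>, only the passage from the
  upper square (zeros) to the lower one (digits \<open>m - 1\<close>) costs a power of
  \<open>gain\<close>. Non-doubling type enters through a contrapositive: if the top row is empty or
  no two adjacent rows are nonempty, no carry meets a run, all comparisons are uniform, and the
  measure is doubling. Finally, runs belong to words, while the almost sure statement is about
  points. Strips around grid lines translate between the two without any question about
  measurability of the index.\<close>

definition expansion :: "nat \<Rightarrow> (nat \<Rightarrow> nat) \<Rightarrow> real" where
  "expansion b u = (\<Sum>t. real (u t) / real b ^ Suc t)"

primrec prefix_value :: "nat \<Rightarrow> (nat \<Rightarrow> nat) \<Rightarrow> nat \<Rightarrow> nat" where
  "prefix_value b u 0 = 0"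
| "prefix_value b u (Suc p) = b * prefix_value b u p + u p"

lemma sums_max_digits:
  assumes "2 \<le> b"
  shows "(\<lambda>t. (real b - 1) / real b ^ Suc t) sums 1"
proof -
  have "(\<lambda>t. (real b - 1) / real b * (1 / real b) ^ t) sums ((real b - 1) / real b * (1 / (1 - 1 / real b)))"
    using assms by (intro sums_mult geometric_sums) auto
  moreover have "(real b - 1) / real b * (1 / (1 - 1 / real b)) = 1"
    using assms by (simp add: field_simps)
  moreover have "(real b - 1) / real b * (1 / real b) ^ t = (real b - 1) / real b ^ Suc t" for t
    by (simp add: power_divide)
  ultimately show ?thesis by (simp only:)
qed

lemma summable_expansion:
  assumes "2 \<le> b" "\<And>t. u t < b"
  shows "summable (\<lambda>t. real (u t) / real b ^ Suc t)"
proof (rule summable_comparison_test)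
  have "real (u t) / real b ^ Suc t \<le> (real b - 1) / real b ^ Suc t" for t
    using assms(1) assms(2)[of t] by (intro divide_right_mono) auto
  then show "\<exists>N. \<forall>t\<ge>N. norm (real (u t) / real b ^ Suc t) \<le> (real b - 1) / real b ^ Suc t"
    by auto
  show "summable (\<lambda>t. (real b - 1) / real b ^ Suc t)"
    using sums_max_digits[OF assms(1)] by (rule sums_summable)
qed

lemma expansion_bounds:
  assumes "2 \<le> b" "\<And>t. u t < b"
  shows "0 \<le> expansion b u" "expansion b u \<le> 1"
proof -
  show "0 \<le> expansion b u"
    unfolding expansion_def by (intro suminf_nonneg summable_expansion assms) simp
  have "expansion b u \<le> (\<Sum>t. (real b - 1) / real b ^ Suc t)"
    unfolding expansion_def
  proof (intro suminf_le summable_expansion assms)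
    show "summable (\<lambda>t. (real b - 1) / real b ^ Suc t)"
      using sums_max_digits[OF assms(1)] by (rule sums_summable)
    show "real (u t) / real b ^ Suc t \<le> (real b - 1) / real b ^ Suc t" for t
      using assms(1) assms(2)[of t] by (intro divide_right_mono) auto
  qed
  also have "\<dots> = 1"
    using sums_max_digits[OF assms(1)] by (simp add: sums_iff)
  finally show "expansion b u \<le> 1" .
qed

lemma expansion_shift:
  assumes "2 \<le> b" "\<And>t. u t < b"
  shows "expansion b u = (expansion b (\<lambda>t. u (Suc t)) + real (u 0)) / real b"
proof -
  have "expansion b u = real (u 0) / real b + (\<Sum>t. real (u (Suc t)) / real b ^ Suc (Suc t))"
    using suminf_split_head[OF summable_expansion[of b u]] assms by (simp add: expansion_def)
  also have "(\<Sum>t. real (u (Suc t)) / real b ^ Suc (Suc t)) = (\<Sum>t. real (u (Suc t)) / real b ^ Suc t / real b)"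
    by (simp add: field_simps)
  also have "\<dots> = expansion b (\<lambda>t. u (Suc t)) / real b"
    unfolding expansion_def using assms by (intro suminf_divide summable_expansion) auto
  finally show ?thesis by (simp add: add_divide_distrib)
qed

lemma expansion_split:
  assumes "2 \<le> b" "\<And>t. u t < b"
  shows "expansion b u = (real (prefix_value b u p) + expansion b (\<lambda>t. u (t + p))) / real b ^ p"
proof (induction p)
  case (Suc p)
  have "expansion b (\<lambda>t. u (t + p)) = (expansion b (\<lambda>t. u (t + Suc p)) + real (u p)) / real b"
    using expansion_shift[of b "\<lambda>t. u (t + p)"] assms by simp
  with Suc show ?case using assms(1) by (simp add: field_simps)
qed simp

text \<open>Both inequalities are non-strict: a tail of digits \<open>b - 1\<close> makes the upper
  one an equality, so \<open>prefix_value\<close> need not be the floor. Later comparisons of points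
  go through this two-sided bound, whichever expansion a point is given by.\<close>

lemma prefix_value_bounds:
  assumes "2 \<le> b" "\<And>t. u t < b"
  shows "real (prefix_value b u p) \<le> real b ^ p * expansion b u"
    and "real b ^ p * expansion b u \<le> real (prefix_value b u p) + 1"
  using expansion_split[of b u p] expansion_bounds[of b "\<lambda>t. u (t + p)"] assms
  by (auto simp: field_simps)

lemma prefix_value_eqD:
  assumes "\<And>t. u t < b" "\<And>t. v t < b" "prefix_value b u p = prefix_value b v p" "i < p"
  shows "u i = v i"
  using assms(3,4)
proof (induction p)
  case (Suc p)
  have "u p = prefix_value b u (Suc p) mod b" "v p = prefix_value b v (Suc p) mod b"
    "prefix_value b u p = prefix_value b u (Suc p) div b" "prefix_value b v p = prefix_value b v (Suc p) div b"
    using assms(1,2)[of p] by auto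
  with Suc show ?case by (metis less_SucE)
qed simp

lemma prefix_value_cong:
  "(\<And>i. i < p \<Longrightarrow> u i = v i) \<Longrightarrow> prefix_value b u p = prefix_value b v p"
  by (induction p) auto

lemma prefix_value_less:
  assumes "\<And>t. u t < b"
  shows "prefix_value b u p < b ^ p"
proof (induction p)
  case (Suc p)
  have "prefix_value b u (Suc p) < b * (prefix_value b u p + 1)" using assms[of p] by simp
  also have "\<dots> \<le> b * b ^ p" using Suc by (intro mult_le_mono2) simp
  finally show ?case by simp
qed simp

lemma prefix_value_zero: "prefix_value b (\<lambda>_. 0) p = 0"
  by (induction p) auto

lemma prefix_value_max: "1 \<le> b \<Longrightarrow> prefix_value b (\<lambda>_. b - 1) p + 1 = b ^ p"
proof (induction p)
  case (Suc p)
  have "prefix_value b (\<lambda>_. b - 1) (Suc p) + 1 = b * (prefix_value b (\<lambda>_. b - 1) p + 1)"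
    using Suc.prems by (simp add: algebra_simps)
  with Suc show ?case by simp
qed simp

section \<open>Digit blocks and the ends of the unit interval\<close>

lemma expansion_le_if_zeros:
  assumes "2 \<le> b" "\<And>t. u t < b" "\<And>t. t < s \<Longrightarrow> u t = 0"
  shows "expansion b u \<le> 1 / real b ^ s"
proof -
  have "prefix_value b u s = 0"
    using prefix_value_cong[of s u "\<lambda>_. 0" b] assms(3) prefix_value_zero by simp
  then show ?thesis
    using prefix_value_bounds(2)[of b u s] assms(1,2) by (simp add: pos_le_divide_eq mult.commute)
qed

lemma expansion_ge_if_max:
  assumes "2 \<le> b" "\<And>t. u t < b" "\<And>t. t < s \<Longrightarrow> u t = b - 1"
  shows "1 - 1 / real b ^ s \<le> expansion b u"
proof -
  have "prefix_value b u s + 1 = b ^ s"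
    using prefix_value_cong[of s u "\<lambda>_. b - 1" b] assms(1,3) prefix_value_max[of b s] by simp
  then have "real (prefix_value b u s) = real b ^ s - 1"
    by (metis add_diff_cancel_right' of_nat_1 of_nat_add of_nat_power)
  then have "real b ^ s - 1 \<le> expansion b u * real b ^ s"
    using prefix_value_bounds(1)[of b u s] assms(1,2) by (simp add: mult.commute)
  then show ?thesis using assms(1) by (simp add: field_simps)
qed

lemma zeros_if_expansion_less:
  assumes "2 \<le> b" "\<And>t. u t < b" "expansion b u < 1 / real b ^ s" "t < s"
  shows "u t = 0"
proof -
  have "real (prefix_value b u s) \<le> real b ^ s * expansion b u"
    using assms(1,2) by (rule prefix_value_bounds)
  also have "\<dots> < 1" using assms(1,3) by (simp add: pos_less_divide_eq mult.commute)
  finally have "prefix_value b u s = prefix_value b (\<lambda>_. 0) s" by (simp add: prefix_value_zero)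
  then show ?thesis using prefix_value_eqD[of u b "\<lambda>_. 0" s t] assms by simp
qed

lemma max_if_expansion_greater:
  assumes "2 \<le> b" "\<And>t. u t < b" "1 - 1 / real b ^ s < expansion b u" "t < s"
  shows "u t = b - 1"
proof -
  have "real b ^ s - 1 < real b ^ s * expansion b u"
    using assms(1,3) by (simp add: field_simps)
  also have "\<dots> \<le> real (prefix_value b u s) + 1"
    using assms(1,2) by (rule prefix_value_bounds)
  finally have "real (b ^ s) < real (prefix_value b u s + 2)" by simp
  then have "b ^ s < prefix_value b u s + 2" by (simp only: of_nat_less_iff)
  then have "prefix_value b u s + 1 = prefix_value b (\<lambda>_. b - 1) s + 1"
    using prefix_value_less[where p=s and b=b and u=u, OF assms(2)] prefix_value_max[of b s] assms(1) by linarith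
  then show ?thesis using prefix_value_eqD[of u b "\<lambda>_. b - 1" s t] assms by simp
qed

text \<open>Incrementing an integer raises one digit and turns every later maximal digit into 0.
  This is the origin of the runs of 0 that face runs of \<open>b - 1\<close>.\<close>

lemma prefix_value_carry:
  assumes "\<And>t. u t < b" "\<And>t. v t < b" "prefix_value b v p = prefix_value b u p + 1"
  shows "\<exists>t0<p. (\<forall>i<t0. v i = u i) \<and> v t0 = u t0 + 1 \<and> (\<forall>i. t0 < i \<and> i < p \<longrightarrow> v i = 0 \<and> u i = b - 1)"
  using assms(3)
proof (induction p)
  case (Suc p)
  have uv: "u p < b" "v p < b" using assms by auto
  let ?V = "prefix_value b v p" and ?U = "prefix_value b u p"
  have eq: "b * ?V + v p = b * ?U + u p + 1" using Suc.prems by simp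
  show ?case
  \<comment> \<open>Either the last digit absorbs the increment and the carry stops at
    \<open>p\<close>, or it wraps from \<open>b - 1\<close> to 0 and the increment passes to the
    shorter prefixes.\<close>
  proof (cases "?V = ?U")
    case True
    then have "v p = u p + 1" using eq by simp
    moreover have "\<forall>i<p. v i = u i" using prefix_value_eqD[OF assms(2,1) True] by auto
    ultimately show ?thesis by (intro exI[of _ p]) auto
  next
    case False
    have "?V > ?U"
    proof (rule ccontr)
      assume "\<not> ?V > ?U"
      with False have "?V + 1 \<le> ?U" by simp
      then have "b * (?V + 1) \<le> b * ?U" by (rule mult_le_mono2)
      then show False using eq uv by simp
    qed
    moreover have "?V < ?U + 2"
    proof (rule ccontr)
      assume "\<not> ?V < ?U + 2"
      then have "b * (?U + 2) \<le> b * ?V" by (intro mult_le_mono2) simp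
      then show False using eq uv by (simp add: algebra_simps)
    qed
    ultimately have V: "?V = ?U + 1" by simp
    then have "b * ?U + b + v p = b * ?U + u p + 1" using eq by (simp add: algebra_simps)
    then have "v p = 0" "u p = b - 1" using uv by auto
    moreover obtain t0 where "t0 < p" "\<forall>i<t0. v i = u i" "v t0 = u t0 + 1"
      "\<forall>i. t0 < i \<and> i < p \<longrightarrow> v i = 0 \<and> u i = b - 1"
      using Suc.IH[OF V] by blast
    ultimately show ?thesis by (intro exI[of _ t0]) (auto simp: less_Suc_eq)
  qed
qed simp

text \<open>Dropping two digits reduces the distance to at most \<open>2 / b ^ 2 \<le> 1 / 2\<close>
  on the scale of the prefix integers. With the rounding error 1 of
  \<open>prefix_value_bounds\<close> the difference stays below 2, even for
  \<open>b = 2\<close>.\<close>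

lemma prefix_value_near:
  assumes "2 \<le> b" "\<And>t. u t < b" "\<And>t. v t < b"
    and "\<bar>expansion b u - expansion b v\<bar> \<le> 2 / real b ^ (p + 2)"
  shows "prefix_value b u p \<le> prefix_value b v p + 1"
proof -
  have "real b ^ p * (expansion b u - expansion b v) \<le> real b ^ p * (2 / real b ^ (p + 2))"
    using assms(4) by (intro mult_left_mono) auto
  also have "\<dots> = 2 / (real b * real b)"
    using assms(1) by (simp add: power_add power2_eq_square)
  also have "\<dots> \<le> 2 / (2 * 2)"
    using assms(1) by (intro divide_left_mono mult_mono) auto
  finally have "real b ^ p * (expansion b u - expansion b v) \<le> 1 / 2" by simp
  then have "real (prefix_value b u p) < real (prefix_value b v p + 2)"
    using prefix_value_bounds[of b u p] prefix_value_bounds[of b v p] assms(1-3)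
    by (simp add: algebra_simps)
  then show ?thesis by linarith
qed

lemma expansion_near:
  assumes "2 \<le> b" "\<And>t. u t < b" "\<And>t. v t < b" "\<And>i. i < p \<Longrightarrow> u i = v i"
  shows "\<bar>expansion b u - expansion b v\<bar> \<le> 1 / real b ^ p"
proof -
  have "\<bar>real b ^ p * expansion b u - real b ^ p * expansion b v\<bar> \<le> 1"
    using prefix_value_bounds[of b u p] prefix_value_bounds[of b v p]
      prefix_value_cong[of p u v b] assms by fastforce
  also have "real b ^ p * expansion b u - real b ^ p * expansion b v = real b ^ p * (expansion b u - expansion b v)"
    by (simp add: algebra_simps)
  finally have "real b ^ p * \<bar>expansion b u - expansion b v\<bar> \<le> 1" by (simp add: abs_mult)
  then show ?thesis using assms(1) by (simp add: pos_le_divide_eq mult.commute)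
qed

text \<open>The bounded perturbation \<open>c\<close> stands for an arbitrary end point: with it the
  lemma covers the images of any bounded orbit under long compositions of the maps, not only
  truncated expansions.\<close>

lemma prefix_value_tendsto:
  assumes "2 \<le> b" "\<And>t. u t < b" "\<And>p. \<bar>c p\<bar> \<le> B"
  shows "(\<lambda>p. (real (prefix_value b u p) + c p) / real b ^ p) \<longlonglongrightarrow> expansion b u"
proof (rule Lim_null[THEN iffD2], rule Lim_null_comparison)
  show "\<forall>\<^sub>F p in sequentially. norm ((real (prefix_value b u p) + c p) / real b ^ p - expansion b u)
      \<le> (B + 1) * (1 / real b) ^ p"
  proof (rule always_eventually, rule allI)
    fix p
    have "(real (prefix_value b u p) + c p) / real b ^ p - expansion b u
        = (c p - expansion b (\<lambda>t. u (t + p))) / real b ^ p"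
      by (subst expansion_split[of b u p]) (use assms in \<open>auto simp: diff_divide_distrib add_divide_distrib\<close>)
    moreover have "\<bar>c p - expansion b (\<lambda>t. u (t + p))\<bar> \<le> B + 1"
      using assms(3)[of p] expansion_bounds[of b "\<lambda>t. u (t + p)"] assms(1,2) by fastforce
    ultimately show "norm ((real (prefix_value b u p) + c p) / real b ^ p - expansion b u) \<le> (B + 1) * (1 / real b) ^ p"
      by (simp add: power_divide divide_right_mono)
  qed
  show "(\<lambda>p. (B + 1) * (1 / real b) ^ p) \<longlonglongrightarrow> 0"
    using assms(1) by (intro tendsto_mult_right_zero LIMSEQ_power_zero) auto
qed

text \<open>Iterating the recursion writes \<open>x 0\<close> as a prefix plus
  \<open>x p / b ^ p\<close>, and boundedness makes the last term vanish. This identifies the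
  coordinates of a point that is pulled back forever inside a compact set.\<close>

lemma expansion_unique:
  assumes "2 \<le> b" "\<And>t. u t < b" "\<And>p. \<bar>x p\<bar> \<le> B"
    and rec: "\<And>p. x p = (x (Suc p) + real (u p)) / real b"
  shows "x 0 = expansion b u"
proof -
  have "x 0 = (real (prefix_value b u p) + x p) / real b ^ p" for p
  proof (induction p)
    case (Suc p)
    then show ?case using rec[of p] assms(1) by (simp add: field_simps)
  qed simp
  then have "(\<lambda>p. (real (prefix_value b u p) + x p) / real b ^ p) = (\<lambda>_. x 0)" by metis
  with prefix_value_tendsto[of b u x B] assms(1-3) show ?thesis
    by (metis LIMSEQ_const_iff)
qed

section \<open>Scales\<close>

text \<open>For \<open>0 < r < 1\<close> this is the largest \<open>k\<close> with
  \<open>r \<le> 1 / b ^ k\<close>; bases \<open>n\<close> and \<open>m\<close> give the two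
  parameters of the approximate square at scale \<open>r\<close>.\<close>

definition level :: "nat \<Rightarrow> real \<Rightarrow> nat" where
  "level b r = nat \<lfloor>- ln r / ln (real b)\<rfloor>"

lemma level_bounds:
  assumes "2 \<le> b" "0 < r" "r < 1"
  shows "real (level b r) \<le> - ln r / ln (real b)" "- ln r / ln (real b) < real (level b r) + 1"
proof -
  have "0 \<le> - ln r / ln (real b)"
    using assms by (intro divide_nonneg_pos) auto
  then show "real (level b r) \<le> - ln r / ln (real b)" "- ln r / ln (real b) < real (level b r) + 1"
    unfolding level_def by linarith+
qed

lemma power_level:
  assumes "2 \<le> b" "0 < r" "r < 1"
  shows "r \<le> 1 / real b ^ level b r" "1 / real b ^ level b r \<le> real b * r"
proof -
  have ln: "0 < ln (real b)" using assms by simp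
  have ln_pow: "ln (1 / real b ^ k) = - (real k * ln (real b))" for k
    using assms by (simp add: ln_div ln_realpow)
  have "ln r \<le> ln (1 / real b ^ level b r)"
    using level_bounds(1)[OF assms] ln ln_pow[of "level b r"] by (simp only: pos_le_divide_eq)
  then show "r \<le> 1 / real b ^ level b r" using assms by simp
  have "ln (1 / real b ^ Suc (level b r)) \<le> ln r"
    using level_bounds(2)[OF assms] ln ln_pow[of "Suc (level b r)"]
    by (simp only: pos_divide_less_eq) (simp add: algebra_simps)
  then have "1 / real b ^ Suc (level b r) \<le> r" using assms by (subst (asm) ln_le_cancel_iff) auto
  then show "1 / real b ^ level b r \<le> real b * r" using assms by (simp add: field_simps)
qed

lemma level_mono:
  assumes "2 \<le> b" "b \<le> c" "0 < r" "r < 1"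
  shows "level c r \<le> level b r"
proof -
  have "- ln r / ln (real c) \<le> - ln r / ln (real b)"
    using assms by (intro divide_left_mono mult_pos_pos) auto
  then show ?thesis unfolding level_def by (intro nat_mono floor_mono)
qed

lemma filterlim_level:
  assumes "2 \<le> b"
  shows "filterlim (level b) at_top (at_right 0)"
proof (rule filterlim_at_top[THEN iffD2], rule allI)
  fix K
  have "\<forall>\<^sub>F r in at_right 0. r < 1 / real b ^ Suc K"
    using assms by (intro order_tendstoD(2)[OF tendsto_ident_at]) auto
  moreover have "\<forall>\<^sub>F r::real in at_right 0. r < 1"
    by (intro order_tendstoD(2)[OF tendsto_ident_at]) auto
  moreover have "\<forall>\<^sub>F r::real in at_right 0. 0 < r" by (rule eventually_at_right_less)
  ultimately show "\<forall>\<^sub>F r in at_right 0. K \<le> level b r"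
  proof eventually_elim
    case (elim r)
    show ?case
    proof (rule ccontr)
      assume "\<not> K \<le> level b r"
      then have "1 / real b ^ K \<le> 1 / real b ^ level b r"
        using assms by (intro divide_left_mono power_increasing) auto
      also have "\<dots> \<le> real b * r" using power_level(2)[of b r] assms elim by simp
      also have "\<dots> < real b * (1 / real b ^ Suc K)"
        using assms elim by (intro mult_strict_left_mono) auto
      also have "\<dots> = 1 / real b ^ K" using assms by simp
      finally show False by simp
    qed
  qed
qed

lemma le_Limsup_along_sequence:
  fixes f :: "real \<Rightarrow> ereal"
  assumes r: "filterlim r F sequentially" and g: "g \<longlonglongrightarrow> c"
    and le: "\<forall>\<^sub>F i in sequentially. ereal (g i) \<le> f (r i)"
  shows "ereal c \<le> Limsup F f"
  unfolding Limsup_def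
proof (rule INF_greatest)
  fix P assume "P \<in> {P. eventually P F}"
  then have "\<forall>\<^sub>F i in sequentially. P (r i)"
    by (intro eventually_compose_filterlim[OF _ r]) simp
  then have "\<forall>\<^sub>F i in sequentially. ereal (g i) \<le> (SUP x\<in>Collect P. f x)"
    using le by eventually_elim (auto intro: SUP_upper2)
  moreover have "(\<lambda>i. ereal (g i)) \<longlonglongrightarrow> ereal c" using g by simp
  ultimately show "ereal c \<le> (SUP x\<in>Collect P. f x)"
    by (intro tendsto_upperbound[of "\<lambda>i. ereal (g i)" "ereal c" sequentially]) simp_all
qed

lemma power_gap:
  fixes M :: nat
  assumes "2 \<le> M" "M ^ i < M ^ i'"
  shows "M * M ^ i \<le> M ^ i'"
proof -
  have "i < i'" using assms power_less_imp_less_exp[of M i i'] by simp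
  then have "M ^ Suc i \<le> M ^ i'" using assms(1) by (intro power_increasing) auto
  then show ?thesis by simp
qed

section \<open>The carpet and its uniform Bernoulli measure\<close>

locale mcmullen =
  fixes n m :: nat and D :: "(nat \<times> nat) set"
  assumes m_ge_2: "2 \<le> m" and m_less_n: "m < n"
    and D_subset: "D \<subseteq> {0..<n} \<times> {0..<m}" and D_nonempty: "D \<noteq> {}"
begin

section \<open>Symbolic coding of the carpet\<close>

definition words :: "(nat \<Rightarrow> nat \<times> nat) set" where
  "words = {w. \<forall>t. w t \<in> D}"

definition code :: "(nat \<Rightarrow> nat \<times> nat) \<Rightarrow> real \<times> real" where
  "code w = (expansion n (\<lambda>t. fst (w t)), expansion m (\<lambda>t. snd (w t)))"

definition word_measure :: "(nat \<Rightarrow> nat \<times> nat) measure" where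
  "word_measure = PiM UNIV (\<lambda>_. measure_pmf (pmf_of_set D))"

lemma n_ge_2: "2 \<le> n"
  using m_ge_2 m_less_n by simp

lemma finite_D: "finite D"
  using D_subset by (rule finite_subset) auto

lemma card_D_pos: "0 < card D"
  using finite_D D_nonempty by (simp add: card_gt_0_iff)

lemma D_bounds: "d \<in> D \<Longrightarrow> fst d < n" "d \<in> D \<Longrightarrow> snd d < m"
  using D_subset by auto

lemma word_bounds:
  assumes "w \<in> words"
  shows "fst (w t) < n" "snd (w t) < m"
  using assms D_bounds by (auto simp: words_def)

lemma shift_word: "w \<in> words \<Longrightarrow> (\<lambda>t. w (Suc t)) \<in> words"
  by (simp add: words_def)

lemma case_nat_word: "d \<in> D \<Longrightarrow> w \<in> words \<Longrightarrow> case_nat d w \<in> words"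
  by (auto simp: words_def split: nat.split)

lemma words_nonempty: "words \<noteq> {}"
  using D_nonempty by (auto simp: words_def)

lemma code_shift:
  assumes "w \<in> words"
  shows "code w = carpet_map n m (w 0) (code (\<lambda>t. w (Suc t)))"
  using expansion_shift[OF n_ge_2, of "\<lambda>t. fst (w t)"] expansion_shift[OF m_ge_2, of "\<lambda>t. snd (w t)"]
    word_bounds[OF assms]
  by (simp add: code_def carpet_map_def)

lemma code_case_nat:
  assumes "d \<in> D" "w \<in> words"
  shows "code (case_nat d w) = carpet_map n m d (code w)"
  using code_shift[OF case_nat_word[OF assms]] by simp

lemma code_image_eq: "code ` words = (\<Union>d\<in>D. carpet_map n m d ` code ` words)"
proof (intro equalityI subsetI)
  fix z assume "z \<in> code ` words"
  then obtain w where w: "w \<in> words" "z = code w" by auto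
  then have "w 0 \<in> D" by (auto simp: words_def)
  with w show "z \<in> (\<Union>d\<in>D. carpet_map n m d ` code ` words)"
    using code_shift[OF w(1)] shift_word[OF w(1)] by blast
next
  fix z assume "z \<in> (\<Union>d\<in>D. carpet_map n m d ` code ` words)"
  then obtain d w where "d \<in> D" "w \<in> words" "z = carpet_map n m d (code w)" by auto
  then show "z \<in> code ` words"
    using code_case_nat case_nat_word by (metis imageI)
qed

text \<open>Each prefix depends on finitely many letters, and the tail after \<open>p\<close> digits
  is at most \<open>b ^ (- p)\<close> uniformly in the word. The purpose is compactness of the coded
  set.\<close>

lemma continuous_on_expansion:
  assumes "2 \<le> b" "\<And>d. d \<in> D \<Longrightarrow> f d < b"
  shows "continuous_on words (\<lambda>w. expansion b (\<lambda>t. f (w t)))"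
proof (rule uniform_limit_theorem)
  show "\<forall>\<^sub>F p in sequentially. continuous_on words (\<lambda>w. real (prefix_value b (\<lambda>t. f (w t)) p) / real b ^ p)"
  proof (rule always_eventually, rule allI)
    fix p
    have "continuous_on words (\<lambda>w. real (prefix_value b (\<lambda>t. f (w t)) p))"
    proof (induction p)
      case (Suc p)
      have "continuous_on UNIV (\<lambda>w::nat \<Rightarrow> nat \<times> nat. w p)"
        by (rule continuous_on_product_coordinates)
      then have "continuous_on words (\<lambda>w::nat \<Rightarrow> nat \<times> nat. w p)"
        by (rule continuous_on_subset) auto
      moreover have "continuous_on ((\<lambda>w. w p) ` words) (\<lambda>d. real (f d))"
      proof -
        have "(\<lambda>w. w p) ` words \<subseteq> D" by (auto simp: words_def)
        then have "finite ((\<lambda>w. w p) ` words)" using finite_D by (rule finite_subset)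
        then show ?thesis by (rule continuous_on_finite)
      qed
      ultimately have "continuous_on words ((\<lambda>d. real (f d)) \<circ> (\<lambda>w. w p))"
        by (rule continuous_on_compose)
      then have "continuous_on words (\<lambda>w. real (f (w p)))"
        unfolding o_def .
      with Suc show ?case by (auto intro!: continuous_intros)
    qed simp
    then show "continuous_on words (\<lambda>w. real (prefix_value b (\<lambda>t. f (w t)) p) / real b ^ p)"
      using assms(1) by (auto intro!: continuous_intros)
  qed
  show "uniform_limit words (\<lambda>p w. real (prefix_value b (\<lambda>t. f (w t)) p) / real b ^ p)
      (\<lambda>w. expansion b (\<lambda>t. f (w t))) sequentially"
  proof (rule uniform_limitI)
    fix e :: real assume "0 < e"
    moreover have "(\<lambda>p. (1 / real b) ^ p) \<longlonglongrightarrow> 0"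
      using assms(1) by (intro LIMSEQ_power_zero) auto
    ultimately have "\<forall>\<^sub>F p in sequentially. (1 / real b) ^ p < e"
      by (rule order_tendstoD(2)[rotated])
    then show "\<forall>\<^sub>F p in sequentially. \<forall>w\<in>words. dist (real (prefix_value b (\<lambda>t. f (w t)) p) / real b ^ p)
        (expansion b (\<lambda>t. f (w t))) < e"
    proof eventually_elim
      case (elim p)
      show ?case
      proof
        fix w assume "w \<in> words"
        then have lt: "f (w t) < b" for t using assms(2) by (auto simp: words_def)
        have "expansion b (\<lambda>t. f (w t)) - real (prefix_value b (\<lambda>t. f (w t)) p) / real b ^ p
            = expansion b (\<lambda>t. f (w (t + p))) / real b ^ p"
          by (subst expansion_split[of b "\<lambda>t. f (w t)" p]) (use assms lt in \<open>auto simp: add_divide_distrib\<close>)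
        moreover have "0 \<le> expansion b (\<lambda>t. f (w (t + p)))" "expansion b (\<lambda>t. f (w (t + p))) \<le> 1"
          using expansion_bounds[of b "\<lambda>t. f (w (t + p))"] assms lt by auto
        ultimately have "dist (real (prefix_value b (\<lambda>t. f (w t)) p) / real b ^ p) (expansion b (\<lambda>t. f (w t)))
            \<le> (1 / real b) ^ p"
          by (simp add: dist_real_def power_divide divide_right_mono abs_minus_commute)
        with elim show "dist (real (prefix_value b (\<lambda>t. f (w t)) p) / real b ^ p) (expansion b (\<lambda>t. f (w t))) < e"
          by simp
      qed
    qed
  qed
qed simp

lemma compact_code_image: "compact (code ` words)"
proof (rule compact_continuous_image)
  show "continuous_on words code"
    unfolding code_def using n_ge_2 m_ge_2 D_bounds
    by (intro continuous_on_Pair continuous_on_expansion) auto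
  have "compactin (product_topology (\<lambda>_::nat. euclidean) UNIV) (PiE UNIV (\<lambda>_. D))"
    by (simp add: compactin_PiE finite_D finite_imp_compact)
  then show "compact words"
    by (simp add: euclidean_product_topology words_def PiE_def Pi_def)
qed

text \<open>Symbolic dynamics replaces the contraction argument on compact sets. A point of
  \<open>E'\<close> has an infinite backward itinerary inside \<open>E'\<close>, which is a word
  coding it. Conversely, pushing a point of \<open>E'\<close> through the maps of the first
  \<open>p\<close> letters of a word stays in \<open>E'\<close> and converges to the code of the
  word.\<close>

lemma invariant_compact_unique:
  assumes ne: "E' \<noteq> {}" and "compact E'" and inv: "E' = (\<Union>d\<in>D. carpet_map n m d ` E')"
  shows "E' = code ` words"
proof (intro equalityI subsetI)
  obtain B where B: "\<And>z. z \<in> E' \<Longrightarrow> norm z \<le> B"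
    using compact_imp_bounded[OF assms(2)] by (auto simp: bounded_iff)
  fix z assume z: "z \<in> E'"
  have "\<forall>z\<in>E'. \<exists>d\<in>D. \<exists>z'\<in>E'. z = carpet_map n m d z'"
    using inv by blast
  then obtain f g where fg: "\<And>z. z \<in> E' \<Longrightarrow> f z \<in> D \<and> g z \<in> E' \<and> z = carpet_map n m (f z) (g z)"
    by metis
  define y where "y p = (g ^^ p) z" for p
  have y: "y p \<in> E'" for p
    by (induction p) (use z fg in \<open>auto simp: y_def\<close>)
  have step: "y p = carpet_map n m (f (y p)) (y (Suc p))" for p
    using fg[OF y[of p]] by (simp add: y_def)
  define w where "w p = f (y p)" for p
  have w: "w \<in> words" using fg[OF y] by (simp add: words_def w_def)
  have "\<bar>fst (y p)\<bar> \<le> B" "\<bar>snd (y p)\<bar> \<le> B" for p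
    using order_trans[OF norm_fst_le[of "fst (y p)" "snd (y p)"]] order_trans[OF norm_snd_le[of "snd (y p)" "fst (y p)"]]
      B[OF y[of p]] by (simp_all only: prod.collapse real_norm_def)
  moreover have "fst (y p) = (fst (y (Suc p)) + real (fst (w p))) / real n"
    "snd (y p) = (snd (y (Suc p)) + real (snd (w p))) / real m" for p
    using arg_cong[OF step[of p], of fst] arg_cong[OF step[of p], of snd] by (simp_all only: carpet_map_def w_def fst_conv snd_conv)
  ultimately have "fst (y 0) = expansion n (\<lambda>t. fst (w t))" "snd (y 0) = expansion m (\<lambda>t. snd (w t))"
    using expansion_unique[OF n_ge_2, of "\<lambda>t. fst (w t)" "\<lambda>p. fst (y p)" B]
      expansion_unique[OF m_ge_2, of "\<lambda>t. snd (w t)" "\<lambda>p. snd (y p)" B] word_bounds[OF w] by blast+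
  then have "z = code w" by (simp add: y_def code_def prod_eq_iff)
  with w show "z \<in> code ` words" by auto
next
  fix z assume "z \<in> code ` words"
  then obtain w where w: "w \<in> words" "z = code w" by auto
  obtain e where e: "e \<in> E'" using ne by auto
  define y where "y p e = ((real (prefix_value n (\<lambda>t. fst (w t)) p) + fst e) / real n ^ p,
      (real (prefix_value m (\<lambda>t. snd (w t)) p) + snd e) / real m ^ p)" for p and e :: "real \<times> real"
  have "y p e \<in> E'" if "e \<in> E'" for p e
    using that
  proof (induction p arbitrary: e)
    case (Suc p)
    have "y (Suc p) e = y p (carpet_map n m (w p) e)"
      using n_ge_2 m_ge_2 by (simp add: y_def carpet_map_def field_simps)
    moreover have "carpet_map n m (w p) e \<in> E'"
      using Suc.prems inv w(1) by (auto simp: words_def)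
    ultimately show ?case using Suc.IH by simp
  qed (simp add: y_def)
  moreover have "(\<lambda>p. y p e) \<longlonglongrightarrow> code w"
    unfolding y_def code_def
    by (intro tendsto_Pair prefix_value_tendsto[of _ _ _ "\<bar>fst e\<bar>"] prefix_value_tendsto[of _ _ _ "\<bar>snd e\<bar>"]
        n_ge_2 m_ge_2 word_bounds[OF w(1)]) auto
  ultimately show "z \<in> E'"
    using closed_sequentially[OF compact_imp_closed[OF assms(2)], of "\<lambda>p. y p e" "code w"] e w(2) by auto
qed

lemma carpet_eq: "carpet n m D = code ` words"
  unfolding carpet_def
proof (rule the_equality)
  show "code ` words \<noteq> {} \<and> compact (code ` words) \<and> code ` words = (\<Union>d\<in>D. carpet_map n m d ` code ` words)"
    using words_nonempty compact_code_image code_image_eq by auto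
qed (use invariant_compact_unique in blast)

section \<open>The Bernoulli measure as the image of a product measure\<close>

sublocale W: sequence_space "measure_pmf (pmf_of_set D)"
  rewrites "PiM UNIV (\<lambda>_. measure_pmf (pmf_of_set D)) \<equiv> word_measure"
  by (unfold_locales) (simp add: word_measure_def)

lemma space_word_measure [simp]: "space word_measure = UNIV"
  by (simp add: word_measure_def space_PiM)

lemma measurable_word_component [measurable]: "(\<lambda>w. w t) \<in> word_measure \<rightarrow>\<^sub>M count_space UNIV"
proof -
  have "(\<lambda>w. w t) \<in> word_measure \<rightarrow>\<^sub>M measure_pmf (pmf_of_set D)"
    unfolding word_measure_def by (rule measurable_component_singleton) simp
  then show ?thesis by simp
qed

lemma measurable_code [measurable]: "code \<in> word_measure \<rightarrow>\<^sub>M borel"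
proof -
  have "(\<lambda>w. real (f (w t))) \<in> borel_measurable word_measure" for f :: "nat \<times> nat \<Rightarrow> nat" and t
    by measurable
  then show ?thesis
    unfolding code_def expansion_def
    by (intro borel_measurable_Pair borel_measurable_suminf borel_measurable_divide) auto
qed

text \<open>The space of \<open>word_measure\<close> contains all sequences of pairs, but digit
  bounds are available on \<open>words\<close> only; statements about codes are transferred through
  this almost sure event.\<close>

lemma AE_words: "AE w in word_measure. w \<in> words"
proof -
  have "AE d in measure_pmf (pmf_of_set D). d \<in> D"
    using finite_D D_nonempty by (simp add: AE_measure_pmf_iff)
  then have "AE w in word_measure. w t \<in> D" for t
    using W.AE_component[of t "\<lambda>d. d \<in> D"] by simp
  then have "AE w in word_measure. \<forall>t. w t \<in> D" by (simp add: AE_all_countable)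
  then show ?thesis by (simp add: words_def)
qed

definition bernoulli :: "(real \<times> real) measure" where
  "bernoulli = distr word_measure borel code"

lemma sets_bernoulli [simp]: "sets bernoulli = sets borel"
  by (simp add: bernoulli_def)

lemma space_bernoulli [simp]: "space bernoulli = UNIV"
  by (simp add: bernoulli_def)

lemma prob_space_word_measure: "prob_space word_measure"
  unfolding word_measure_def by (rule W.P.prob_space_axioms[unfolded word_measure_def])

lemma prob_space_bernoulli: "prob_space bernoulli"
  unfolding bernoulli_def by (rule prob_space.prob_space_distr[OF prob_space_word_measure measurable_code])

text \<open>The product measure is the image under \<open>case_nat\<close> of the law of one letter
  times itself, and integrating over the first letter is a finite average. This is self-similarity
  on the symbolic side.\<close>

lemma emeasure_word_measure_Cons:
  assumes "X \<in> sets word_measure"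
  shows "emeasure word_measure X = (\<Sum>d\<in>D. emeasure word_measure {w. case_nat d w \<in> X}) / card D"
proof -
  let ?M = "measure_pmf (pmf_of_set D)"
  have iter: "distr (?M \<Otimes>\<^sub>M word_measure) word_measure (\<lambda>(d, w). case_nat d w) = word_measure"
    using W.PiM_iter by (simp add: word_measure_def)
  have meas: "(\<lambda>(d, w). case_nat d w) \<in> ?M \<Otimes>\<^sub>M word_measure \<rightarrow>\<^sub>M word_measure"
    unfolding word_measure_def by measurable
  have "emeasure word_measure X
      = emeasure (?M \<Otimes>\<^sub>M word_measure) ((\<lambda>(d, w). case_nat d w) -` X \<inter> space (?M \<Otimes>\<^sub>M word_measure))"
    by (subst iter[symmetric], rule emeasure_distr[OF meas assms])
  also have "\<dots> = (\<integral>\<^sup>+ d. emeasure word_measure (Pair d -` ((\<lambda>(d, w). case_nat d w) -` X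
      \<inter> space (?M \<Otimes>\<^sub>M word_measure))) \<partial>?M)"
    using prob_space_imp_sigma_finite[OF prob_space_word_measure] measurable_sets[OF meas assms]
    by (rule sigma_finite_measure.emeasure_pair_measure_alt)
  also have "\<dots> = (\<integral>\<^sup>+ d. emeasure word_measure {w. case_nat d w \<in> X} \<partial>?M)"
    by (intro nn_integral_cong arg_cong2[where f=emeasure]) (auto simp: space_pair_measure)
  also have "\<dots> = (\<Sum>d\<in>D. emeasure word_measure {w. case_nat d w \<in> X}) / card D"
    by (rule nn_integral_pmf_of_set[OF D_nonempty finite_D])
  finally show ?thesis .
qed

lemma measurable_carpet_map [measurable]: "carpet_map n m d \<in> borel \<rightarrow>\<^sub>M borel"
  unfolding carpet_map_def
  by (intro borel_measurable_continuous_onI continuous_intros) (use n_ge_2 m_ge_2 in auto)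

lemma bernoulli_self_similar:
  assumes A [measurable]: "A \<in> sets borel"
  shows "measure bernoulli A = 1 / real (card D) * (\<Sum>d\<in>D. measure bernoulli (carpet_map n m d -` A))"
proof -
  interpret \<mu>: prob_space bernoulli by (rule prob_space_bernoulli)
  have set1: "code -` A \<in> sets word_measure" if [measurable]: "A \<in> sets borel" for A
    using measurable_sets[OF measurable_code that] by simp
  have em: "emeasure bernoulli A = emeasure word_measure (code -` A)" if "A \<in> sets borel" for A
    using that by (simp add: bernoulli_def emeasure_distr)
  have "emeasure word_measure {w. case_nat d w \<in> code -` A} = emeasure bernoulli (carpet_map n m d -` A)"
    if "d \<in> D" for d
  proof -
    have meas: "carpet_map n m d -` A \<in> sets borel"
      using measurable_sets[OF measurable_carpet_map A] by simp
    have case_meas: "case_nat d \<in> word_measure \<rightarrow>\<^sub>M word_measure"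
      unfolding word_measure_def by measurable
    have "AE w in word_measure. w \<in> {w. case_nat d w \<in> code -` A} \<longleftrightarrow> w \<in> code -` (carpet_map n m d -` A)"
      using AE_words by eventually_elim (use that code_case_nat in auto)
    then have "emeasure word_measure {w. case_nat d w \<in> code -` A} = emeasure word_measure (code -` (carpet_map n m d -` A))"
      using set1[OF meas] measurable_sets[OF case_meas set1[OF A]]
      by (intro emeasure_eq_AE) (auto simp: vimage_def)
    also have "\<dots> = emeasure bernoulli (carpet_map n m d -` A)"
      by (rule em[OF meas, symmetric])
    finally show ?thesis .
  qed
  then have "emeasure bernoulli A = (\<Sum>d\<in>D. emeasure bernoulli (carpet_map n m d -` A)) / card D"
    using emeasure_word_measure_Cons[OF set1[OF A]] em[OF A] by simp
  also have "\<dots> = ennreal (1 / real (card D) * (\<Sum>d\<in>D. measure bernoulli (carpet_map n m d -` A)))"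
    using card_D_pos
    by (simp add: \<mu>.emeasure_eq_measure sum_nonneg ennreal_of_nat_eq_real_of_nat divide_ennreal sum_ennreal)
  finally show ?thesis
    by (simp add: \<mu>.emeasure_eq_measure sum_nonneg)
qed

lemma closed_carpet: "closed (carpet n m D)"
  using compact_code_image by (simp add: carpet_eq compact_imp_closed)

lemma emeasure_bernoulli_compl_carpet: "emeasure bernoulli (- carpet n m D) = 0"
proof -
  have "AE w in word_measure. w \<notin> code -` (- carpet n m D)"
    using AE_words by eventually_elim (auto simp: carpet_eq)
  moreover have meas: "- carpet n m D \<in> sets borel"
    using closed_carpet by auto
  moreover have "code -` (- carpet n m D) \<in> sets word_measure"
    using measurable_sets[OF measurable_code meas] by simp
  ultimately show ?thesis
    using AE_iff_measurable[of "code -` (- carpet n m D)" word_measure "\<lambda>w. w \<notin> code -` (- carpet n m D)"]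
    by (simp add: bernoulli_def emeasure_distr vimage_def)
qed

section \<open>Uniqueness of the self-similar measure\<close>

definition is_carpet_measure :: "(real \<times> real) measure \<Rightarrow> bool" where
  "is_carpet_measure M \<longleftrightarrow> sets M = sets borel \<and> prob_space M \<and>
     emeasure M (- carpet n m D) = 0 \<and>
     (\<forall>A\<in>sets borel. measure M A = 1 / real (card D) * (\<Sum>d\<in>D. measure M (carpet_map n m d -` A)))"

lemma dist_carpet:
  assumes "x \<in> carpet n m D" "y \<in> carpet n m D"
  shows "dist x y < 3"
proof -
  have "0 \<le> fst z" "fst z \<le> 1" "0 \<le> snd z" "snd z \<le> 1" if "z \<in> carpet n m D" for z
    using that expansion_bounds n_ge_2 m_ge_2 word_bounds by (fastforce simp: carpet_eq code_def)+
  then have "\<bar>fst x - fst y\<bar> \<le> 1" "\<bar>snd x - snd y\<bar> \<le> 1"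
    using assms by (smt (verit))+
  moreover have "dist x y \<le> \<bar>fst x - fst y\<bar> + \<bar>snd x - snd y\<bar>"
    by (cases x, cases y) (simp add: dist_Pair_Pair dist_real_def sqrt_sum_squares_le_sum_abs)
  ultimately show ?thesis by simp
qed

lemma dist_carpet_map: "dist (carpet_map n m d x) (carpet_map n m d y) \<le> dist x y / real m"
proof -
  have "dist (carpet_map n m d x) (carpet_map n m d y)
      = sqrt (((fst x - fst y) / real n)\<^sup>2 + ((snd x - snd y) / real m)\<^sup>2)"
    by (simp add: carpet_map_def dist_Pair_Pair dist_real_def diff_divide_distrib add_divide_distrib)
  also have "\<dots> \<le> sqrt (((fst x - fst y) / real m)\<^sup>2 + ((snd x - snd y) / real m)\<^sup>2)"
  proof (intro real_sqrt_le_mono add_right_mono)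
    have "\<bar>(fst x - fst y) / real n\<bar> \<le> \<bar>(fst x - fst y) / real m\<bar>"
      using m_less_n m_ge_2 by (simp add: frac_le)
    then show "((fst x - fst y) / real n)\<^sup>2 \<le> ((fst x - fst y) / real m)\<^sup>2"
      by (simp only: abs_le_square_iff)
  qed
  also have "\<dots> = sqrt ((fst x - fst y)\<^sup>2 + (snd x - snd y)\<^sup>2) / real m"
    by (simp add: power_divide add_divide_distrib[symmetric] real_sqrt_divide)
  also have "\<dots> = dist x y / real m"
    by (cases x, cases y) (simp add: dist_Pair_Pair dist_real_def)
  finally show ?thesis .
qed

text \<open>A Prokhorov-type contraction. Self-similarity replaces \<open>C\<close> by its preimages
  under the maps, and since these shrink distances at least by the factor \<open>m\<close>, a
  neighbourhood of radius \<open>3 / m ^ p\<close> of a preimage is carried into one of radius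
  \<open>3 / m ^ (p + 1)\<close> of \<open>C\<close>. The induction starts because 3 exceeds the
  diameter of the carpet.\<close>

lemma carpet_measure_thickening:
  assumes M: "is_carpet_measure M" and M': "is_carpet_measure M'" and "closed C"
  shows "measure M C \<le> measure M' (\<Union>y\<in>C. ball y (3 / real m ^ p))"
  using \<open>closed C\<close>
proof (induction p arbitrary: C)
  case 0
  interpret M: prob_space M using M by (simp add: is_carpet_measure_def)
  interpret M': prob_space M' using M' by (simp add: is_carpet_measure_def)
  have sets: "sets M = sets borel" "sets M' = sets borel"
    using M M' by (auto simp: is_carpet_measure_def)
  let ?U = "\<Union>y\<in>C. ball y 3"
  show ?case
  proof (cases "C \<inter> carpet n m D = {}")
    case True
    then have "emeasure M C \<le> emeasure M (- carpet n m D)"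
      using sets closed_carpet by (intro emeasure_mono) auto
    then have "measure M C = 0"
      using M by (simp add: is_carpet_measure_def measure_def)
    then show ?thesis by simp
  next
    case False
    then have "carpet n m D \<subseteq> ?U" using dist_carpet by fastforce
    moreover have "emeasure M' (- ?U) \<le> emeasure M' (- carpet n m D)"
      using sets closed_carpet calculation by (intro emeasure_mono) auto
    ultimately have "emeasure M' (space M' - ?U) = 0"
      using M' sets_eq_imp_space_eq[OF sets(2)] by (auto simp: is_carpet_measure_def Compl_eq_Diff_UNIV)
    then have "measure M' (space M' - ?U) = 0" by (simp add: measure_def)
    moreover have "?U \<in> sets M'" using sets by (auto intro!: borel_open open_UN)
    ultimately have "measure M' ?U = 1" using M'.prob_compl[of ?U] by simp
    then show ?thesis using M.prob_le_1 by simp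
  qed
next
  case (Suc p)
  interpret M': prob_space M' using M' by (simp add: is_carpet_measure_def)
  have sets: "sets M = sets borel" "sets M' = sets borel"
    using M M' by (auto simp: is_carpet_measure_def)
  let ?U = "\<lambda>C. \<lambda>p. \<Union>y\<in>C. ball y (3 / real m ^ p)"
  have U: "?U B q \<in> sets borel" for B :: "(real \<times> real) set" and q
    by (intro borel_open open_UN) auto
  have C: "C \<in> sets borel" using Suc.prems by auto
  have "measure M (carpet_map n m d -` C) \<le> measure M' (carpet_map n m d -` ?U C (Suc p))" for d
  proof -
    have "continuous_on UNIV (carpet_map n m d)"
      unfolding carpet_map_def by (intro continuous_intros) (use n_ge_2 m_ge_2 in auto)
    then have "closed (carpet_map n m d -` C)"
      using Suc.prems continuous_closed_vimage[of C "carpet_map n m d"]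
      by (auto simp: continuous_on_eq_continuous_at)
    then have "measure M (carpet_map n m d -` C) \<le> measure M' (?U (carpet_map n m d -` C) p)"
      by (rule Suc.IH)
    also have "\<dots> \<le> measure M' (carpet_map n m d -` ?U C (Suc p))"
    proof (rule M'.finite_measure_mono)
      show "?U (carpet_map n m d -` C) p \<subseteq> carpet_map n m d -` ?U C (Suc p)"
      proof
        fix x assume "x \<in> ?U (carpet_map n m d -` C) p"
        then obtain y where y: "carpet_map n m d y \<in> C" "dist y x < 3 / real m ^ p"
          unfolding UN_iff vimage_eq mem_ball by blast
        have "dist (carpet_map n m d y) (carpet_map n m d x) \<le> dist y x / real m"
          by (rule dist_carpet_map)
        also have "\<dots> < 3 / real m ^ p / real m"
          using y(2) m_ge_2 by (intro divide_strict_right_mono) auto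
        finally have "dist (carpet_map n m d y) (carpet_map n m d x) < 3 / real m ^ Suc p"
          by (simp add: mult.commute)
        with y(1) show "x \<in> carpet_map n m d -` ?U C (Suc p)" by auto
      qed
      show "carpet_map n m d -` ?U C (Suc p) \<in> sets M'"
        using measurable_sets[OF measurable_carpet_map U[of "Suc p" C]] sets by simp
    qed
    finally show ?thesis .
  qed
  then have "1 / real (card D) * (\<Sum>d\<in>D. measure M (carpet_map n m d -` C))
      \<le> 1 / real (card D) * (\<Sum>d\<in>D. measure M' (carpet_map n m d -` ?U C (Suc p)))"
    by (intro mult_left_mono sum_mono) auto
  then show ?case
    using M M' C U[of "Suc p" C] unfolding is_carpet_measure_def by metis
qed

text \<open>As \<open>p\<close> grows, the neighbourhoods shrink to the closed set. Exchanging the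
  two measures then gives equality on closed sets, a generator stable under intersection.\<close>

lemma carpet_measure_le_closed:
  assumes M: "is_carpet_measure M" and M': "is_carpet_measure M'" and C: "closed C"
  shows "measure M C \<le> measure M' C"
proof -
  interpret M': prob_space M' using M' by (simp add: is_carpet_measure_def)
  let ?U = "\<lambda>p. \<Union>y\<in>C. ball y (3 / real m ^ p)"
  have lim: "(\<lambda>p. 3 / real m ^ p) \<longlonglongrightarrow> 0"
    using m_ge_2 LIMSEQ_power_zero[of "1 / real m"] tendsto_mult_right_zero[of "\<lambda>p. (1 / real m) ^ p" sequentially 3]
    by (simp add: power_divide)
  have "(\<Inter>p. ?U p) = C"
  proof (intro equalityI subsetI)
    fix x assume x: "x \<in> (\<Inter>p. ?U p)"
    have "\<exists>y\<in>C. dist y x < e" if e: "0 < e" for e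
    proof -
      obtain p where "3 / real m ^ p < e"
        using order_tendstoD(2)[OF lim e] by (auto simp: eventually_sequentially)
      moreover obtain y where "y \<in> C" "dist y x < 3 / real m ^ p" using x by fastforce
      ultimately show ?thesis by (intro bexI[of _ y]) auto
    qed
    then show "x \<in> C" using C closed_approachable by blast
  next
    fix x assume "x \<in> C"
    moreover have "x \<in> ball x (3 / real m ^ p)" for p using m_ge_2 by simp
    ultimately show "x \<in> (\<Inter>p. ?U p)" by blast
  qed
  moreover have "(\<lambda>p. measure M' (?U p)) \<longlonglongrightarrow> measure M' (\<Inter>p. ?U p)"
  proof (rule M'.finite_Lim_measure_decseq)
    show "range ?U \<subseteq> sets M'"
      using M' by (auto simp: is_carpet_measure_def intro!: borel_open open_UN)
    show "decseq ?U"
    proof (rule decseq_SucI)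
      fix p
      have "3 / real m ^ Suc p \<le> 3 / real m ^ p"
        using m_ge_2 by (intro divide_left_mono power_increasing) auto
      then show "?U (Suc p) \<subseteq> ?U p"
        using subset_ball by (intro UN_mono) auto
    qed
  qed
  ultimately show ?thesis
    using carpet_measure_thickening[OF M M' C] by (intro LIMSEQ_le_const) auto
qed

lemma carpet_measure_unique:
  assumes "is_carpet_measure M" "is_carpet_measure M'"
  shows "M = M'"
proof (rule measure_eqI_generator_eq[where E="Collect closed" and \<Omega>=UNIV and A="\<lambda>_. UNIV"])
  interpret M: prob_space M using assms by (simp add: is_carpet_measure_def)
  interpret M': prob_space M' using assms by (simp add: is_carpet_measure_def)
  show "emeasure M X = emeasure M' X" if "X \<in> Collect closed" for X
    using carpet_measure_le_closed[OF assms, of X] carpet_measure_le_closed[OF assms(2,1), of X] that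
    by (simp add: M.emeasure_eq_measure M'.emeasure_eq_measure)
  show "Int_stable (Collect (closed :: (real \<times> real) set \<Rightarrow> bool))"
    by (auto simp: Int_stable_def)
  show "sets M = sigma_sets UNIV (Collect closed)" "sets M' = sigma_sets UNIV (Collect closed)"
    using assms by (simp_all add: is_carpet_measure_def borel_eq_closed)
  show "emeasure M UNIV \<noteq> \<infinity>" for i :: nat by simp
qed auto

lemma carpet_measure_eq: "carpet_measure n m D = bernoulli"
  unfolding carpet_measure_def
proof (rule the_equality)
  show *: "sets bernoulli = sets borel \<and> prob_space bernoulli \<and> emeasure bernoulli (- carpet n m D) = 0 \<and>
     (\<forall>A\<in>sets borel. measure bernoulli A = 1 / real (card D) * (\<Sum>d\<in>D. measure bernoulli (carpet_map n m d -` A)))"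
    using prob_space_bernoulli emeasure_bernoulli_compl_carpet bernoulli_self_similar by simp
  show "M = bernoulli" if "sets M = sets borel \<and> prob_space M \<and> emeasure M (- carpet n m D) = 0 \<and>
     (\<forall>A\<in>sets borel. measure M A = 1 / real (card D) * (\<Sum>d\<in>D. measure M (carpet_map n m d -` A)))" for M
    using carpet_measure_unique[of M bernoulli] that * unfolding is_carpet_measure_def by argo
qed

section \<open>Measures of balls\<close>

text \<open>Fiber counts appear where only the row is prescribed. The factor 1 before
  \<open>k\<close> puts all weights over one index set, so that two words can be compared position
  by position.\<close>

definition weight :: "nat \<Rightarrow> nat \<Rightarrow> (nat \<Rightarrow> nat \<times> nat) \<Rightarrow> real" where
  "weight k l w = (\<Prod>t<l. if t < k then 1 else real (fiber_count D (snd (w t)))) / real (card D) ^ l"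

definition cylinder :: "nat \<Rightarrow> nat \<Rightarrow> (nat \<Rightarrow> nat \<times> nat) \<Rightarrow> (nat \<Rightarrow> nat \<times> nat) set" where
  "cylinder k l w = {v. \<forall>t<l. v t \<in> (if t < k then {w t} else {d. snd d = snd (w t)})}"

lemma finite_fiber: "finite {i. (i, j) \<in> D}"
  by (rule finite_subset[of _ "{0..<n}"]) (use D_subset in auto)

lemma fiber_count_le: "fiber_count D j \<le> n"
proof -
  have "fiber_count D j \<le> card {0..<n}"
    unfolding fiber_count_def using D_subset by (intro card_mono) auto
  then show ?thesis by simp
qed

lemma fiber_count_pos_iff: "0 < fiber_count D j \<longleftrightarrow> (\<exists>i. (i, j) \<in> D)"
  using finite_fiber by (auto simp: fiber_count_def card_gt_0_iff)

lemma fiber_count_word: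
  assumes "w \<in> words"
  shows "1 \<le> fiber_count D (snd (w t))"
proof -
  have "(fst (w t), snd (w t)) \<in> D" using assms by (simp add: words_def)
  then have "0 < fiber_count D (snd (w t))" unfolding fiber_count_pos_iff by blast
  then show ?thesis by simp
qed

lemma weight_pos: "w \<in> words \<Longrightarrow> 0 < weight k l w"
  unfolding weight_def using fiber_count_word[of w] card_D_pos
  by (intro divide_pos_pos prod_pos) (auto simp: less_eq_Suc_le)

lemma measurable_cylinder [measurable]: "cylinder k l w \<in> sets word_measure"
proof -
  have "{v \<in> space word_measure. \<forall>t\<in>{..<l}. v t \<in> (if t < k then {w t} else {d. snd d = snd (w t)})} \<in> sets word_measure"
    by measurable
  then show ?thesis by (simp add: cylinder_def lessThan_def Ball_def)
qed

lemma card_fiber: "card (D \<inter> {d. snd d = j}) = fiber_count D j"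
proof -
  have "D \<inter> {d. snd d = j} = (\<lambda>i. (i, j)) ` {i. (i, j) \<in> D}" by force
  then show ?thesis by (simp add: fiber_count_def card_image inj_on_def)
qed

lemma measure_cylinder:
  assumes "w \<in> words"
  shows "measure word_measure (cylinder k l w) = weight k l w"
proof -
  let ?X = "\<lambda>t. if t < k then {w t} else {d. snd d = snd (w t)}"
  have "emeasure word_measure (cylinder k l w) = (\<Prod>t<l. emeasure (measure_pmf (pmf_of_set D)) (?X t))"
    using W.emeasure_PiM_Collect[of "{..<l}" ?X] by (simp add: cylinder_def Ball_def)
  also have "\<dots> = (\<Prod>t<l. ennreal (measure (measure_pmf (pmf_of_set D)) (?X t)))"
    by (simp add: measure_pmf.emeasure_eq_measure)
  also have "\<dots> = (\<Prod>t<l. ennreal ((if t < k then 1 else real (fiber_count D (snd (w t)))) / card D))"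
  proof (intro prod.cong refl arg_cong[where f=ennreal])
    fix t
    have "D \<inter> {w t} = {w t}" using assms by (auto simp: words_def)
    then show "measure (measure_pmf (pmf_of_set D)) (?X t) = (if t < k then 1 else real (fiber_count D (snd (w t)))) / card D"
      using measure_pmf_of_set[OF D_nonempty finite_D, of "?X t"] card_fiber by simp
  qed
  also have "\<dots> = ennreal (weight k l w)"
    by (subst prod_ennreal) (auto simp: weight_def prod_dividef)
  finally show ?thesis
    using weight_pos[OF assms, of k l] by (simp add: measure_def)
qed

lemma measure_bernoulli:
  "A \<in> sets borel \<Longrightarrow> measure bernoulli A = measure word_measure (code -` A)"
  by (simp add: bernoulli_def measure_distr)

lemma dist_plane_le: "dist x y \<le> \<bar>fst x - fst y\<bar> + \<bar>snd x - snd y\<bar>" for x y :: "real \<times> real"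
  by (cases x, cases y) (simp add: dist_Pair_Pair dist_real_def sqrt_sum_squares_le_sum_abs)

lemma abs_fst_snd_le_dist:
  "\<bar>fst x - fst y\<bar> \<le> dist x y" "\<bar>snd x - snd y\<bar> \<le> dist x y" for x y :: "real \<times> real"
  using dist_fst_le[of x y] dist_snd_le[of x y] by (auto simp: dist_real_def)

lemma dist_code_le:
  assumes "v \<in> words" "w \<in> words"
    and "\<And>t. t < k \<Longrightarrow> fst (v t) = fst (w t)" "\<And>t. t < l \<Longrightarrow> snd (v t) = snd (w t)"
  shows "dist (code v) (code w) \<le> 1 / real n ^ k + 1 / real m ^ l"
proof -
  have "\<bar>fst (code v) - fst (code w)\<bar> \<le> 1 / real n ^ k" "\<bar>snd (code v) - snd (code w)\<bar> \<le> 1 / real m ^ l"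
    unfolding code_def fst_conv snd_conv
    using assms by (intro expansion_near n_ge_2 m_ge_2 word_bounds; blast)+
  then show ?thesis using dist_plane_le[of "code v" "code w"] by linarith
qed

lemma measure_ball_ge_weight:
  assumes w: "w \<in> words" and "k \<le> l" "1 / real n ^ k + 1 / real m ^ l < r"
  shows "weight k l w \<le> measure bernoulli (ball (code w) r \<inter> carpet n m D)"
proof -
  have B: "ball (code w) r \<inter> carpet n m D \<in> sets borel" using closed_carpet by auto
  have "measure word_measure (cylinder k l w) \<le> measure word_measure (code -` (ball (code w) r \<inter> carpet n m D))"
  proof (rule W.P.finite_measure_mono_AE)
    show "AE v in word_measure. v \<in> cylinder k l w \<longrightarrow> v \<in> code -` (ball (code w) r \<inter> carpet n m D)"
      using AE_words
    proof eventually_elim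
      case (elim v)
      show ?case
      proof
        assume v: "v \<in> cylinder k l w"
        have "snd (v t) = snd (w t)" if "t < l" for t
          using v that by (auto simp: cylinder_def split: if_splits)
        moreover have "fst (v t) = fst (w t)" if "t < k" for t
          using v that less_le_trans[OF that \<open>k \<le> l\<close>] by (auto simp: cylinder_def)
        ultimately have "dist (code w) (code v) \<le> 1 / real n ^ k + 1 / real m ^ l"
          using dist_code_le[of w v k l] elim w by simp
        with assms(3) show "v \<in> code -` (ball (code w) r \<inter> carpet n m D)"
          using elim by (auto simp: carpet_eq)
      qed
    qed
    show "code -` (ball (code w) r \<inter> carpet n m D) \<in> sets word_measure"
      using measurable_sets[OF measurable_code B] by simp
  qed
  then show ?thesis by (simp add: measure_cylinder[OF w] measure_bernoulli[OF B])
qed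

lemma card_nat_open_interval: "finite {i::nat. c < real i \<and> real i < c + 3}" "card {i::nat. c < real i \<and> real i < c + 3} \<le> 3"
proof -
  have sub: "{i::nat. c < real i \<and> real i < c + 3} \<subseteq> nat ` {\<lfloor>c\<rfloor> + 1..\<lfloor>c\<rfloor> + 3}"
  proof
    fix i assume "i \<in> {i::nat. c < real i \<and> real i < c + 3}"
    then have "int i \<in> {\<lfloor>c\<rfloor> + 1..\<lfloor>c\<rfloor> + 3}" by simp linarith
    then show "i \<in> nat ` {\<lfloor>c\<rfloor> + 1..\<lfloor>c\<rfloor> + 3}" by (metis image_eqI nat_int)
  qed
  then show "finite {i::nat. c < real i \<and> real i < c + 3}" by (rule finite_subset) auto
  have "card {i::nat. c < real i \<and> real i < c + 3} \<le> card (nat ` {\<lfloor>c\<rfloor> + 1..\<lfloor>c\<rfloor> + 3})"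
    using sub by (intro card_mono) auto
  also have "\<dots> \<le> 3" using card_image_le[of "{\<lfloor>c\<rfloor> + 1..\<lfloor>c\<rfloor> + 3}" nat] by simp
  finally show "card {i::nat. c < real i \<and> real i < c + 3} \<le> 3" .
qed

text \<open>The scaled expansion is within 1 of \<open>b ^ p * x\<close>, and the prefix integer is
  at most 1 below the scaled expansion. So the integer lies in an open interval of length 3 and has
  at most three possible values; the form \<open>- 2 + 3\<close> matches
  \<open>card_nat_open_interval\<close>.\<close>

lemma prefix_value_window:
  assumes "2 \<le> b" "\<And>t. u t < b" "\<bar>expansion b u - x\<bar> < r" "r \<le> 1 / real b ^ p"
  shows "real b ^ p * x - 2 < real (prefix_value b u p)" "real (prefix_value b u p) < real b ^ p * x - 2 + 3"
proof -
  have "real b ^ p * \<bar>expansion b u - x\<bar> < 1"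
    using order_less_le_trans[OF assms(3,4)] assms(1) by (simp add: pos_less_divide_eq mult.commute)
  then have "\<bar>real b ^ p * expansion b u - real b ^ p * x\<bar> < 1"
    by (simp add: abs_mult right_diff_distrib[symmetric])
  then show "real b ^ p * x - 2 < real (prefix_value b u p)" "real (prefix_value b u p) < real b ^ p * x - 2 + 3"
    using prefix_value_bounds[of b u p] assms(1,2) by (simp_all add: abs_less_iff)
qed

text \<open>Words coding points of the ball show at most \<open>3 * 3\<close> pairs of prefix
  integers, and words with the same pair lie in one cylinder. The bound \<open>B\<close> is demanded
  only for words coding into the ball, so each cylinder is represented by such a word.\<close>

lemma measure_ball_le_weight:
  assumes "k \<le> l" "r \<le> 1 / real n ^ k" "r \<le> 1 / real m ^ l" "0 \<le> B"
    and B: "\<And>w. w \<in> words \<Longrightarrow> code w \<in> ball z r \<Longrightarrow> weight k l w \<le> B"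
  shows "measure bernoulli (ball z r \<inter> carpet n m D) \<le> 9 * B"
proof -
  have ball: "ball z r \<inter> carpet n m D \<in> sets borel" using closed_carpet by auto
  define A where "A = {w \<in> words. code w \<in> ball z r}"
  define key where "key w = (prefix_value n (\<lambda>t. fst (w t)) k, prefix_value m (\<lambda>t. snd (w t)) l)"
    for w :: "nat \<Rightarrow> nat \<times> nat"
  define rep where "rep s = (SOME w. w \<in> A \<and> key w = s)" for s
  let ?I = "\<lambda>c. {i::nat. c < real i \<and> real i < c + 3}"
  let ?S = "?I (real n ^ k * fst z - 2) \<times> ?I (real m ^ l * snd z - 2)"
  have sub: "key ` A \<subseteq> ?S"
  proof
    fix s assume "s \<in> key ` A"
    then obtain w where w: "w \<in> words" "dist z (code w) < r" "s = key w" by (auto simp: A_def)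
    then have "\<bar>expansion n (\<lambda>t. fst (w t)) - fst z\<bar> < r" "\<bar>expansion m (\<lambda>t. snd (w t)) - snd z\<bar> < r"
      using abs_fst_snd_le_dist[of z "code w"] by (auto simp: code_def)
    then show "s \<in> ?S"
      using prefix_value_window[OF n_ge_2, of "\<lambda>t. fst (w t)" "fst z" r k]
        prefix_value_window[OF m_ge_2, of "\<lambda>t. snd (w t)" "snd z" r l] word_bounds[OF w(1)] assms(2,3)
      unfolding w(3) key_def mem_Times_iff mem_Collect_eq fst_conv snd_conv by blast
  qed
  have finS: "finite ?S" using card_nat_open_interval by blast
  have "card ?S \<le> 3 * 3"
    unfolding card_cartesian_product by (intro mult_le_mono card_nat_open_interval)
  then have card: "card (key ` A) \<le> 9" using card_mono[OF finS sub] by simp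
  have fin: "finite (key ` A)" using sub finS by (rule finite_subset)
  have rep: "rep s \<in> A" "key (rep s) = s" if "s \<in> key ` A" for s
    using that someI_ex[of "\<lambda>w. w \<in> A \<and> key w = s"] unfolding rep_def by auto
  have "measure word_measure (code -` (ball z r \<inter> carpet n m D)) \<le> measure word_measure (\<Union>s\<in>key ` A. cylinder k l (rep s))"
  proof (rule W.P.finite_measure_mono_AE)
    show "AE w in word_measure. w \<in> code -` (ball z r \<inter> carpet n m D) \<longrightarrow> w \<in> (\<Union>s\<in>key ` A. cylinder k l (rep s))"
      using AE_words
    proof eventually_elim
      case (elim v)
      show ?case
      proof
        assume "v \<in> code -` (ball z r \<inter> carpet n m D)"
        then have v: "v \<in> A" using elim by (simp add: A_def)
        define u where "u = rep (key v)"
        have u: "u \<in> words" "key u = key v" using rep[of "key v"] v by (auto simp: A_def u_def)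
        have eq: "prefix_value n (\<lambda>t. fst (v t)) k = prefix_value n (\<lambda>t. fst (u t)) k"
          "prefix_value m (\<lambda>t. snd (v t)) l = prefix_value m (\<lambda>t. snd (u t)) l"
          using u(2) by (simp_all add: key_def)
        have "snd (v t) = snd (u t)" if "t < l" for t
          using prefix_value_eqD[OF _ _ eq(2) that] word_bounds[OF elim] word_bounds[OF u(1)] by blast
        moreover have "fst (v t) = fst (u t)" if "t < k" for t
          using prefix_value_eqD[OF _ _ eq(1) that] word_bounds[OF elim] word_bounds[OF u(1)] by blast
        ultimately have "v \<in> cylinder k l (rep (key v))"
          using \<open>k \<le> l\<close> unfolding u_def by (auto simp: cylinder_def prod_eq_iff)
        with v show "v \<in> (\<Union>s\<in>key ` A. cylinder k l (rep s))" by blast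
      qed
    qed
    show "(\<Union>s\<in>key ` A. cylinder k l (rep s)) \<in> sets word_measure"
      using fin by (intro sets.finite_UN measurable_cylinder)
  qed
  also have "\<dots> \<le> (\<Sum>s\<in>key ` A. measure word_measure (cylinder k l (rep s)))"
    using fin by (intro W.P.finite_measure_subadditive_finite) auto
  also have "\<dots> \<le> (\<Sum>s\<in>key ` A. B)"
    using rep B by (intro sum_mono) (auto simp: A_def measure_cylinder)
  also have "\<dots> \<le> 9 * B"
    using card \<open>0 \<le> B\<close> by (simp add: mult_right_mono)
  finally show ?thesis by (simp add: measure_bernoulli[OF ball])
qed

text \<open>Under a simultaneous step of both scales the row at \<open>k\<close> leaves the product
  (a factor at most \<open>n\<close>), a row enters at \<open>l\<close> (a factor at least 1), and
  one more division by \<open>card D\<close> appears.\<close>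

lemma weight_le_weight_Suc:
  assumes "w \<in> words"
  shows "weight k l w \<le> real n * real (card D) * weight (Suc k) (Suc l) w"
proof -
  let ?f = "\<lambda>k t. if t < k then 1 else real (fiber_count D (snd (w t)))"
  have ge1: "1 \<le> real (fiber_count D (snd (w t)))" for t using fiber_count_word[OF assms, of t] by simp
  have "(\<Prod>t<l. ?f k t) \<le> (\<Prod>t<l. (if t = k then real n else 1) * ?f (Suc k) t)"
    using fiber_count_le ge1 order_trans[OF zero_le_one ge1] by (intro prod_mono) (auto simp: less_Suc_eq)
  also have "\<dots> = (\<Prod>t<l. if t = k then real n else 1) * (\<Prod>t<l. ?f (Suc k) t)"
    by (rule prod.distrib)
  also have "\<dots> \<le> real n * (\<Prod>t<Suc l. ?f (Suc k) t)"
  proof (intro mult_mono)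
    show "(\<Prod>t<l. if t = k then real n else 1) \<le> real n"
      using n_ge_2 by (simp add: prod.delta')
    have "(\<Prod>t<l. ?f (Suc k) t) * 1 \<le> (\<Prod>t<l. ?f (Suc k) t) * ?f (Suc k) l"
      using ge1 by (intro mult_left_mono prod_nonneg) auto
    then show "(\<Prod>t<l. ?f (Suc k) t) \<le> (\<Prod>t<Suc l. ?f (Suc k) t)" by simp
  qed (auto intro!: prod_nonneg)
  finally have "(\<Prod>t<l. ?f k t) \<le> real n * (\<Prod>t<Suc l. ?f (Suc k) t)" .
  then have "(\<Prod>t<l. ?f k t) / real (card D) ^ l \<le> real n * (\<Prod>t<Suc l. ?f (Suc k) t) / real (card D) ^ l"
    by (intro divide_right_mono) auto
  also have "\<dots> = real n * real (card D) * ((\<Prod>t<Suc l. ?f (Suc k) t) / real (card D) ^ Suc l)"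
    using card_D_pos by (simp del: prod.lessThan_Suc)
  finally show ?thesis unfolding weight_def .
qed

lemma weight_le_weight_add:
  assumes "w \<in> words"
  shows "weight k l w \<le> (real n * real (card D)) ^ c * weight (k + c) (l + c) w"
proof (induction c)
  case (Suc c)
  have "(real n * real (card D)) ^ c * weight (k + c) (l + c) w
      \<le> (real n * real (card D)) ^ c * (real n * real (card D) * weight (Suc (k + c)) (Suc (l + c)) w)"
    by (intro mult_left_mono weight_le_weight_Suc assms) auto
  with Suc show ?case by (simp add: mult_ac)
qed simp

text \<open>Shrinking the radius by \<open>\<rho>\<close> costs only a constant: refine both scales
  \<open>c\<close> times, with \<open>m ^ c\<close> beyond \<open>2 * n / \<rho>\<close>. The 2
  accounts for the two sides of the square, and \<open>n * r\<close> is the slack of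
  \<open>power_level\<close>, common to both bases.\<close>

lemma weight_le_measure_ball:
  assumes "0 < \<rho>"
  obtains C where "0 < C" and
    "\<And>r k l w. \<lbrakk>w \<in> words; 0 < r; k \<le> l; 1 / real n ^ k \<le> real n * r; 1 / real m ^ l \<le> real n * r\<rbrakk> \<Longrightarrow>
     weight k l w \<le> C * measure bernoulli (ball (code w) (\<rho> * r) \<inter> carpet n m D)"
proof -
  obtain c where c: "2 * real n / \<rho> < real m ^ c"
    using real_arch_pow[of "real m" "2 * real n / \<rho>"] m_ge_2 by auto
  define C where "C = (real n * real (card D)) ^ c"
  have C: "0 < C" using n_ge_2 card_D_pos by (simp add: C_def)
  moreover have "weight k l w \<le> C * measure bernoulli (ball (code w) (\<rho> * r) \<inter> carpet n m D)"
    if w: "w \<in> words" and r: "0 < r" "k \<le> l" "1 / real n ^ k \<le> real n * r" "1 / real m ^ l \<le> real n * r"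
    for r k l w
  proof -
    have "1 / real n ^ (k + c) \<le> real n * r / real m ^ c"
    proof -
      have "1 / real n ^ (k + c) = 1 / real n ^ k / real n ^ c" by (simp add: power_add)
      also have "\<dots> \<le> real n * r / real m ^ c"
        using r m_less_n m_ge_2 by (intro frac_le power_mono) auto
      finally show ?thesis .
    qed
    moreover have "1 / real m ^ (l + c) \<le> real n * r / real m ^ c"
    proof -
      have "1 / real m ^ (l + c) = 1 / real m ^ l / real m ^ c" by (simp add: power_add)
      also have "\<dots> \<le> real n * r / real m ^ c"
        using r by (intro divide_right_mono) auto
      finally show ?thesis .
    qed
    moreover have "2 * (real n * r / real m ^ c) < \<rho> * r"
      using c \<open>0 < \<rho>\<close> \<open>0 < r\<close> m_ge_2 by (simp add: field_simps)
    ultimately have small: "1 / real n ^ (k + c) + 1 / real m ^ (l + c) < \<rho> * r"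
      unfolding mult_2 by (meson add_mono le_less_trans)
    have "weight k l w \<le> C * weight (k + c) (l + c) w"
      unfolding C_def by (rule weight_le_weight_add[OF w])
    also have "\<dots> \<le> C * measure bernoulli (ball (code w) (\<rho> * r) \<inter> carpet n m D)"
      using C measure_ball_ge_weight[OF w _ small] r(2) by (intro mult_left_mono) auto
    finally show ?thesis .
  qed
  ultimately show ?thesis by (rule that)
qed

text \<open>What remains to be supplied is \<open>F\<close>: a bound for the weights met by the
  large ball in terms of the weight at the centre of the small one. The constant is chosen before
  the radius and the words.\<close>

lemma measure_ball_compare:
  assumes "0 < \<rho>"
  obtains C where "0 < C" and
    "\<And>r k l w w' F. \<lbrakk>w \<in> words; w' \<in> words; 0 < r; k \<le> l; r \<le> 1 / real n ^ k; r \<le> 1 / real m ^ l;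
       1 / real n ^ k \<le> real n * r; 1 / real m ^ l \<le> real n * r; 0 \<le> F;
       \<And>v. v \<in> words \<Longrightarrow> code v \<in> ball (code w) r \<Longrightarrow> weight k l v \<le> F * weight k l w'\<rbrakk> \<Longrightarrow>
     measure bernoulli (ball (code w) r \<inter> carpet n m D)
       \<le> C * F * measure bernoulli (ball (code w') (\<rho> * r) \<inter> carpet n m D)"
proof -
  obtain C where C: "0 < C" and
    "\<And>r k l w. \<lbrakk>w \<in> words; 0 < r; k \<le> l; 1 / real n ^ k \<le> real n * r; 1 / real m ^ l \<le> real n * r\<rbrakk> \<Longrightarrow>
     weight k l w \<le> C * measure bernoulli (ball (code w) (\<rho> * r) \<inter> carpet n m D)"
    using weight_le_measure_ball[OF assms] by blast
  note lower = this(2)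
  have "measure bernoulli (ball (code w) r \<inter> carpet n m D)
       \<le> 9 * C * F * measure bernoulli (ball (code w') (\<rho> * r) \<inter> carpet n m D)"
    if w: "w \<in> words" "w' \<in> words" and r: "0 < r" "k \<le> l" "r \<le> 1 / real n ^ k" "r \<le> 1 / real m ^ l"
      "1 / real n ^ k \<le> real n * r" "1 / real m ^ l \<le> real n * r" and "0 \<le> F"
      and F: "\<And>v. v \<in> words \<Longrightarrow> code v \<in> ball (code w) r \<Longrightarrow> weight k l v \<le> F * weight k l w'"
    for r k l w w' F
  proof -
    have "measure bernoulli (ball (code w) r \<inter> carpet n m D) \<le> 9 * (F * weight k l w')"
      using r F \<open>0 \<le> F\<close> weight_pos[OF w(2), of k l] by (intro measure_ball_le_weight[of k l]) auto
    also have "\<dots> \<le> 9 * (F * (C * measure bernoulli (ball (code w') (\<rho> * r) \<inter> carpet n m D)))"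
      using \<open>0 \<le> F\<close> lower[OF w(2) r(1,2,5,6)] by (intro mult_left_mono) auto
    finally show ?thesis by (simp add: mult_ac)
  qed
  moreover have "0 < 9 * C" using C by simp
  ultimately show ?thesis using that by blast
qed

section \<open>Positivity of balls and a criterion for doubling\<close>

lemma measure_ball_pos:
  assumes "z \<in> carpet n m D" "0 < r"
  shows "0 < measure bernoulli (ball z r \<inter> carpet n m D)"
proof -
  obtain w where w: "w \<in> words" "z = code w" using assms(1) by (auto simp: carpet_eq)
  obtain c where c: "2 / r < real m ^ c"
    using real_arch_pow[of "real m" "2 / r"] m_ge_2 by auto
  have "1 / real n ^ c \<le> 1 / real m ^ c"
    using m_less_n m_ge_2 by (intro frac_le power_mono) auto
  moreover have "2 * (1 / real m ^ c) < r"
    using c \<open>0 < r\<close> m_ge_2 by (simp add: field_simps)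
  ultimately have "1 / real n ^ c + 1 / real m ^ c < r" by linarith
  then show ?thesis
    using measure_ball_ge_weight[OF w(1) order_refl] weight_pos[OF w(1), of c c] w(2) by fastforce
qed

lemma measure_Int_carpet:
  assumes "A \<in> sets borel"
  shows "measure bernoulli (A \<inter> carpet n m D) = measure bernoulli A"
proof -
  have "AE z in bernoulli. z \<notin> - carpet n m D"
    using emeasure_bernoulli_compl_carpet closed_carpet
    by (intro AE_not_in) (auto simp: null_sets_def)
  then show ?thesis
    using assms closed_carpet by (intro measure_eq_AE) auto
qed

lemma measure_support_bernoulli: "measure_support bernoulli \<subseteq> carpet n m D"
proof
  fix x assume x: "x \<in> measure_support bernoulli"
  show "x \<in> carpet n m D"
  proof (rule ccontr)
    assume "x \<notin> carpet n m D"
    then have "0 < emeasure bernoulli (- carpet n m D)"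
      using x closed_carpet unfolding measure_support_def by (auto simp: open_Compl)
    then show False by (simp add: emeasure_bernoulli_compl_carpet)
  qed
qed

lemma doubling_measure_bernoulli:
  assumes "\<And>x r. x \<in> carpet n m D \<Longrightarrow> 0 < r \<Longrightarrow>
    measure bernoulli (ball x (2 * r) \<inter> carpet n m D) \<le> K * measure bernoulli (ball x r \<inter> carpet n m D)"
  shows "doubling_measure bernoulli"
proof -
  interpret \<mu>: prob_space bernoulli by (rule prob_space_bernoulli)
  have "emeasure bernoulli (ball x (2 * r)) / emeasure bernoulli (ball x r) \<le> ennreal K"
    if "x \<in> measure_support bernoulli" "0 < r" for x r
  proof -
    have x: "x \<in> carpet n m D" using that(1) measure_support_bernoulli by auto
    then have pos: "0 < measure bernoulli (ball x r)"
      using measure_ball_pos[OF x that(2)] by (simp add: measure_Int_carpet)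
    have "measure bernoulli (ball x (2 * r)) \<le> K * measure bernoulli (ball x r)"
      using assms[OF x that(2)] by (simp add: measure_Int_carpet)
    then have "measure bernoulli (ball x (2 * r)) / measure bernoulli (ball x r) \<le> K"
      using pos by (simp add: pos_divide_le_eq)
    then show ?thesis
      using pos by (simp add: \<mu>.emeasure_eq_measure divide_ennreal ennreal_leI)
  qed
  then have "(SUP (x, r) \<in> measure_support bernoulli \<times> {0<..}.
      emeasure bernoulli (ball x (2 * r)) / emeasure bernoulli (ball x r)) \<le> ennreal K"
    by (intro SUP_least) auto
  also have "\<dots> < \<infinity>" by simp
  finally show ?thesis by (simp add: doubling_measure_def)
qed

end

section \<open>Comparison of nearby approximate squares\<close>

locale asymmetric_mcmullen = mcmullen +
  assumes fiber_less: "fiber_count D (m - 1) < fiber_count D 0"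
begin

text \<open>If the top row is empty, carries never involve a run, and \<open>1\<close> replaces the junk value \<open>x / 0\<close>.\<close>

definition gain :: real where
  "gain = (if fiber_count D (m - 1) = 0 then 1 else real (fiber_count D 0) / real (fiber_count D (m - 1)))"

definition boundary_run :: "(nat \<Rightarrow> nat \<times> nat) \<Rightarrow> nat \<Rightarrow> nat \<Rightarrow> bool" where
  "boundary_run w a p \<longleftrightarrow> (\<forall>i\<in>{a..<p}. snd (w i) = 0) \<or> (\<forall>i\<in>{a..<p}. snd (w i) = m - 1)"

lemma gain_ge_1: "1 \<le> gain"
  using fiber_less by (auto simp: gain_def)

lemma gain_pos: "0 < gain"
  using gain_ge_1 by linarith

text \<open>Fiber counts along a word lie between 1 and \<open>n\<close>, so each exceptional
  position in \<open>A\<close> costs at most \<open>n\<close>. Three are enough: the position of a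
  carry and the two digits given up by \<open>prefix_value_near\<close>. The factor \<open>G\<close>
  is left free because the lemma serves both directions, with \<open>gain\<close> and with
  \<open>1 / gain\<close>.\<close>

lemma weight_le_weight:
  assumes "v \<in> words" "u \<in> words" "0 < G" "A \<subseteq> {..<l}" "Z \<subseteq> {k..<l}" "A \<inter> Z = {}" "card A \<le> 3"
    and eq: "\<And>t. t < l \<Longrightarrow> k \<le> t \<Longrightarrow> t \<notin> A \<Longrightarrow> t \<notin> Z \<Longrightarrow> fiber_count D (snd (v t)) \<le> fiber_count D (snd (u t))"
    and Z: "\<And>t. t \<in> Z \<Longrightarrow> real (fiber_count D (snd (v t))) \<le> G * real (fiber_count D (snd (u t)))"
  shows "weight k l v \<le> real n ^ 3 * G ^ card Z * weight k l u"
proof -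
  let ?f = "\<lambda>w t. if t < k then 1 else real (fiber_count D (snd (w t)))"
  let ?g = "\<lambda>t. (if t \<in> A then real n else 1) * (if t \<in> Z then G else 1)"
  have n1: "1 \<le> real n" using n_ge_2 by simp
  have "?f v t \<le> ?g t * ?f u t" if "t < l" for t
  proof -
    have u1: "1 \<le> real (fiber_count D (snd (u t)))" using fiber_count_word[OF assms(2), of t] by simp
    consider "t < k" "t \<notin> Z" | "k \<le> t" "t \<in> A" "t \<notin> Z" | "k \<le> t" "t \<notin> A" "t \<in> Z" | "k \<le> t" "t \<notin> A" "t \<notin> Z"
      using assms(5,6) by fastforce
    then show ?thesis
    proof cases
      case 1
      then show ?thesis using n1 by simp
    next
      case 2
      have "real (fiber_count D (snd (v t))) \<le> real n * 1" using fiber_count_le by simp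
      also have "\<dots> \<le> real n * real (fiber_count D (snd (u t)))" using u1 by (intro mult_left_mono) auto
      finally show ?thesis using 2 by simp
    next
      case 3
      then show ?thesis using Z[of t] by simp
    next
      case 4
      then show ?thesis using eq[of t] that by simp
    qed
  qed
  then have "(\<Prod>t<l. ?f v t) \<le> (\<Prod>t<l. ?g t * ?f u t)"
    by (intro prod_mono) auto
  also have "\<dots> = (\<Prod>t<l. if t \<in> A then real n else 1) * (\<Prod>t<l. if t \<in> Z then G else 1) * (\<Prod>t<l. ?f u t)"
    by (simp only: prod.distrib)
  also have "(\<Prod>t<l. if t \<in> A then real n else 1) = real n ^ card A"
    using assms(4) by (simp add: prod.If_cases Int_absorb1 Int_absorb2)
  also have "(\<Prod>t<l. if t \<in> Z then G else 1) = G ^ card Z"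
  proof -
    have "Z \<subseteq> {..<l}" using assms(5) by auto
    then show ?thesis by (simp add: prod.If_cases Int_absorb1 Int_absorb2)
  qed
  also have "real n ^ card A * G ^ card Z * (\<Prod>t<l. ?f u t) \<le> real n ^ 3 * G ^ card Z * (\<Prod>t<l. ?f u t)"
    using n1 \<open>0 < G\<close> assms(7) by (intro mult_right_mono power_increasing prod_nonneg) auto
  finally show ?thesis
    unfolding weight_def by (simp add: divide_right_mono)
qed

text \<open>The last conjunct records what a costly run forces on \<open>D\<close>: the carry shows
  two adjacent nonempty rows, and the run below the line shows the row \<open>m - 1\<close>. From it
  the combinatorial consequences of non-doubling are derived.\<close>

lemma weight_compare:
  assumes w: "w \<in> words" and v: "v \<in> words" and u: "u \<in> words" and "k \<le> l"
    and near: "\<bar>snd (code v) - snd (code w)\<bar> \<le> 1 / real m ^ l" "\<bar>snd (code u) - snd (code w)\<bar> \<le> 1 / real m ^ l"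
  shows "\<exists>s\<le>l - 2 - k. boundary_run w (l - 2 - s) (l - 2) \<and> weight k l v \<le> real n ^ 3 * gain ^ s * weight k l u \<and>
    (0 < s \<longrightarrow> 0 < fiber_count D (m - 1) \<and> (\<exists>j. 0 < fiber_count D j \<and> 0 < fiber_count D (Suc j)))"
proof -
  define p where "p = l - 2"
  have p: "p \<le> l" "card {p..<l} \<le> 2" by (auto simp: p_def)
  let ?Y = "\<lambda>x. prefix_value m (\<lambda>t. snd (x t)) p"
  have Y_near: "?Y x \<le> ?Y y + 1" if "x \<in> words" "y \<in> words" "\<bar>snd (code x) - snd (code y)\<bar> \<le> 2 / real m ^ l" for x y
  \<comment> \<open>For \<open>l < 2\<close> truncated subtraction gives \<open>p = 0\<close>, and
    all these integers are 0.\<close>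
  proof (cases "l < 2")
    case False
    then have "p + 2 = l" by (simp add: p_def)
    then show ?thesis
      using prefix_value_near[OF m_ge_2, of "\<lambda>t. snd (x t)" "\<lambda>t. snd (y t)" p] that word_bounds
      by (simp add: code_def)
  qed (simp add: p_def)
  have m_pos: "0 \<le> 1 / real m ^ l" by simp
  have two: "2 / real m ^ l = 1 / real m ^ l + 1 / real m ^ l" by simp
  have vw: "?Y v \<le> ?Y w + 1" "?Y w \<le> ?Y v + 1" and uw: "?Y u \<le> ?Y w + 1" "?Y w \<le> ?Y u + 1"
    and vu: "?Y v \<le> ?Y u + 1" "?Y u \<le> ?Y v + 1"
    using near m_pos unfolding abs_le_iff
    by (intro Y_near w v u; unfold abs_le_iff two; linarith)+
  have same: "snd (x i) = snd (y i)" if "?Y x = ?Y y" "x \<in> words" "y \<in> words" "i < p" for x y i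
    using prefix_value_eqD[of "\<lambda>t. snd (x t)" m "\<lambda>t. snd (y t)" p i] that word_bounds by blast
  have run0: "boundary_run w (p - 0) p" by (simp add: boundary_run_def)
  consider "?Y v = ?Y u" | "?Y u = ?Y v + 1" | "?Y v = ?Y u + 1" using vu by linarith
  then show ?thesis
  proof cases
    case 1
    have "weight k l v \<le> real n ^ 3 * gain ^ card ({} :: nat set) * weight k l u"
    proof (rule weight_le_weight[where A="{p..<l}" and Z="{}", OF v u gain_pos])
      show "fiber_count D (snd (v t)) \<le> fiber_count D (snd (u t))" if "t < l" "t \<notin> {p..<l}" for t
        using same[OF 1 v u, of t] that by simp
    qed (use p in auto)
    with run0 show ?thesis unfolding p_def by (intro exI[of _ 0]) simp
  next
    \<comment> \<open>Here \<open>u\<close> lies above: after the carry its zeros face digits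
      \<open>m - 1\<close> of \<open>v\<close>, and by \<open>fiber_less\<close> nothing is lost
      beyond the exceptional positions.\<close>
    case 2
    then obtain t0 where t0: "t0 < p" "\<And>i. i < t0 \<Longrightarrow> snd (u i) = snd (v i)"
        "\<And>i. t0 < i \<Longrightarrow> i < p \<Longrightarrow> snd (u i) = 0 \<and> snd (v i) = m - 1"
      using prefix_value_carry[of "\<lambda>t. snd (v t)" m "\<lambda>t. snd (u t)" p] word_bounds[OF v] word_bounds[OF u]
      by blast
    have "weight k l v \<le> real n ^ 3 * gain ^ card ({} :: nat set) * weight k l u"
    proof (rule weight_le_weight[where A="insert t0 {p..<l}" and Z="{}", OF v u gain_pos])
      show "fiber_count D (snd (v t)) \<le> fiber_count D (snd (u t))" if "t < l" "t \<notin> insert t0 {p..<l}" for t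
        using t0(2,3)[of t] that fiber_less by (cases t t0 rule: linorder_cases) auto
    qed (use p t0 in \<open>auto simp: card_insert_if\<close>)
    with run0 show ?thesis unfolding p_def by (intro exI[of _ 0]) simp
  next
    case 3
    then obtain t0 where t0: "t0 < p" "\<And>i. i < t0 \<Longrightarrow> snd (v i) = snd (u i)" "snd (v t0) = snd (u t0) + 1"
        "\<And>i. t0 < i \<Longrightarrow> i < p \<Longrightarrow> snd (v i) = 0 \<and> snd (u i) = m - 1"
      using prefix_value_carry[of "\<lambda>t. snd (u t)" m "\<lambda>t. snd (v t)" p] word_bounds[OF v] word_bounds[OF u]
      by blast
    \<comment> \<open>The run begins after the carry, but only its part in the window from
      \<open>k\<close> to \<open>p\<close> enters the weights; the \<open>min\<close> covers an
      empty window.\<close>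
    define q where "q = min p (max k (Suc t0))"
    have fib_pos: "0 < fiber_count D (m - 1)" if "t0 < i" "i < p" for i
      using fiber_count_word[OF u, of i] t0(4)[OF that] by simp
    have "weight k l v \<le> real n ^ 3 * gain ^ card {q..<p} * weight k l u"
    proof (rule weight_le_weight[where A="insert t0 {p..<l}" and Z="{q..<p}", OF v u gain_pos])
      show "fiber_count D (snd (v t)) \<le> fiber_count D (snd (u t))"
        if "t < l" "k \<le> t" "t \<notin> insert t0 {p..<l}" "t \<notin> {q..<p}" for t
        using t0(2)[of t] that by (auto simp: q_def)
      show "real (fiber_count D (snd (v t))) \<le> gain * real (fiber_count D (snd (u t)))" if "t \<in> {q..<p}" for t
      proof -
        have "t0 < t" "t < p" using that by (auto simp: q_def)
        with t0(4)[of t] fib_pos[of t] show ?thesis by (simp add: gain_def)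
      qed
    qed (use p t0 in \<open>auto simp: card_insert_if q_def\<close>)
    moreover have "boundary_run w q p"
    proof -
      have "?Y w = ?Y v \<or> ?Y w = ?Y u" using 3 vw uw by linarith
      then show ?thesis
      proof
        assume "?Y w = ?Y v"
        then have "\<forall>i\<in>{q..<p}. snd (w i) = 0"
          using same[OF _ w v] t0(4) by (auto simp: q_def)
        then show ?thesis by (simp add: boundary_run_def)
      next
        assume "?Y w = ?Y u"
        then have "\<forall>i\<in>{q..<p}. snd (w i) = m - 1"
          using same[OF _ w u] t0(4) by (auto simp: q_def)
        then show ?thesis by (simp add: boundary_run_def)
      qed
    qed
    moreover have "0 < fiber_count D (m - 1) \<and> (\<exists>j. 0 < fiber_count D j \<and> 0 < fiber_count D (Suc j))" if "0 < p - q"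
    proof
      have "t0 < p - 1" using that by (auto simp: q_def)
      then show "0 < fiber_count D (m - 1)" using fib_pos[of "p - 1"] t0(1) by simp
      show "\<exists>j. 0 < fiber_count D j \<and> 0 < fiber_count D (Suc j)"
        using fiber_count_word[OF u, of t0] fiber_count_word[OF v, of t0] t0(3)
        by (intro exI[of _ "snd (u t0)"]) simp
    qed
    moreover have "p - (p - q) = q" "p - q \<le> p - k" by (auto simp: q_def)
    ultimately show ?thesis unfolding p_def[symmetric] by (intro exI[of _ "p - q"]) simp
  qed
qed

text \<open>The cap \<open>p - k\<close> keeps the run inside the window. The length 0 always
  qualifies, so the maximum is over a nonempty finite set.\<close>

definition run_length :: "nat \<Rightarrow> nat \<Rightarrow> (nat \<Rightarrow> nat \<times> nat) \<Rightarrow> nat" where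
  "run_length k p w = Max {s. s \<le> p - k \<and> boundary_run w (p - s) p}"

lemma run_length:
  shows run_length_le: "run_length k p w \<le> p - k"
    and boundary_run_run_length: "boundary_run w (p - run_length k p w) p"
    and run_length_ge: "s \<le> p - k \<Longrightarrow> boundary_run w (p - s) p \<Longrightarrow> s \<le> run_length k p w"
proof -
  let ?S = "{s. s \<le> p - k \<and> boundary_run w (p - s) p}"
  have fin: "finite ?S" by (rule finite_subset[of _ "{..p - k}"]) auto
  have "0 \<in> ?S" by (simp add: boundary_run_def)
  then have "Max ?S \<in> ?S" using fin by (intro Max_in) auto
  then show "run_length k p w \<le> p - k" "boundary_run w (p - run_length k p w) p"
    by (auto simp: run_length_def)
  show "s \<le> run_length k p w" if "s \<le> p - k" "boundary_run w (p - s) p"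
    unfolding run_length_def using that fin by (intro Max_ge) auto
qed

lemma measure_ball_compare_run:
  assumes "0 < \<rho>"
  obtains C where "0 < C" and
    "\<And>r k l w w'. \<lbrakk>w \<in> words; w' \<in> words; 0 < r; k \<le> l; r \<le> 1 / real n ^ k; r \<le> 1 / real m ^ l;
       1 / real n ^ k \<le> real n * r; 1 / real m ^ l \<le> real n * r; code w' \<in> ball (code w) r\<rbrakk> \<Longrightarrow>
     measure bernoulli (ball (code w) r \<inter> carpet n m D)
       \<le> C * gain ^ run_length k (l - 2) w * measure bernoulli (ball (code w') (\<rho> * r) \<inter> carpet n m D)"
proof -
  obtain C where C: "0 < C" and
    "\<And>r k l w w' F. \<lbrakk>w \<in> words; w' \<in> words; 0 < r; k \<le> l; r \<le> 1 / real n ^ k; r \<le> 1 / real m ^ l;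
       1 / real n ^ k \<le> real n * r; 1 / real m ^ l \<le> real n * r; 0 \<le> F;
       \<And>v. v \<in> words \<Longrightarrow> code v \<in> ball (code w) r \<Longrightarrow> weight k l v \<le> F * weight k l w'\<rbrakk> \<Longrightarrow>
     measure bernoulli (ball (code w) r \<inter> carpet n m D)
       \<le> C * F * measure bernoulli (ball (code w') (\<rho> * r) \<inter> carpet n m D)"
    using measure_ball_compare[OF assms] by blast
  note compare = this(2)
  have "measure bernoulli (ball (code w) r \<inter> carpet n m D)
       \<le> C * real n ^ 3 * gain ^ run_length k (l - 2) w * measure bernoulli (ball (code w') (\<rho> * r) \<inter> carpet n m D)"
    if w: "w \<in> words" "w' \<in> words" and r: "0 < r" "k \<le> l" "r \<le> 1 / real n ^ k" "r \<le> 1 / real m ^ l"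
      "1 / real n ^ k \<le> real n * r" "1 / real m ^ l \<le> real n * r" and w': "code w' \<in> ball (code w) r"
    for r k l w w'
  proof -
    let ?F = "real n ^ 3 * gain ^ run_length k (l - 2) w"
    have "weight k l v \<le> ?F * weight k l w'" if v: "v \<in> words" "code v \<in> ball (code w) r" for v
    proof -
      have "\<bar>snd (code v) - snd (code w)\<bar> \<le> 1 / real m ^ l" "\<bar>snd (code w') - snd (code w)\<bar> \<le> 1 / real m ^ l"
        using abs_fst_snd_le_dist(2)[of "code v" "code w"] abs_fst_snd_le_dist(2)[of "code w'" "code w"]
          v(2) w' r(4) by (simp_all add: dist_commute)
      then obtain s where s: "s \<le> l - 2 - k" "boundary_run w (l - 2 - s) (l - 2)"
          "weight k l v \<le> real n ^ 3 * gain ^ s * weight k l w'"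
        using weight_compare[OF w(1) v(1) w(2) r(2)] by blast
      have "gain ^ s \<le> gain ^ run_length k (l - 2) w"
        using run_length_ge[OF s(1,2)] gain_ge_1 by (rule power_increasing)
      then have "real n ^ 3 * gain ^ s * weight k l w' \<le> ?F * weight k l w'"
        using weight_pos[OF w(2), of k l] by (intro mult_right_mono mult_left_mono) auto
      with s(3) show ?thesis by linarith
    qed
    moreover have "0 \<le> ?F" using gain_ge_1 by simp
    ultimately show ?thesis using compare[OF w r, of ?F] by (simp add: mult.assoc)
  qed
  moreover have "0 < C * real n ^ 3" using C n_ge_2 by simp
  ultimately show ?thesis using that by blast
qed

text \<open>The exponent \<open>s\<close> of \<open>weight_compare\<close> is then always 0, so all
  weights met by a ball agree up to \<open>n ^ 3\<close>. This is one direction of the known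
  characterisation of doubling carpets, for \<open>a_0 > a_(m-1)\<close>.\<close>

lemma doubling_without_carries:
  assumes no_carry: "\<not> (0 < fiber_count D (m - 1) \<and> (\<exists>j. 0 < fiber_count D j \<and> 0 < fiber_count D (Suc j)))"
  shows "doubling_measure bernoulli"
proof -
  interpret \<mu>: prob_space bernoulli by (rule prob_space_bernoulli)
  obtain C where C: "0 < C" and
    "\<And>r k l w w' F. \<lbrakk>w \<in> words; w' \<in> words; 0 < r; k \<le> l; r \<le> 1 / real n ^ k; r \<le> 1 / real m ^ l;
       1 / real n ^ k \<le> real n * r; 1 / real m ^ l \<le> real n * r; 0 \<le> F;
       \<And>v. v \<in> words \<Longrightarrow> code v \<in> ball (code w) r \<Longrightarrow> weight k l v \<le> F * weight k l w'\<rbrakk> \<Longrightarrow>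
     measure bernoulli (ball (code w) r \<inter> carpet n m D)
       \<le> C * F * measure bernoulli (ball (code w') (1 / 2 * r) \<inter> carpet n m D)"
    using measure_ball_compare[of "1 / 2"] by (metis half_gt_zero zero_less_one)
  note compare = this(2)
  let ?K = "max (C * real n ^ 3) (real (card D) ^ 3)"
  have "measure bernoulli (ball x (2 * r) \<inter> carpet n m D) \<le> ?K * measure bernoulli (ball x r \<inter> carpet n m D)"
    if x: "x \<in> carpet n m D" and "0 < r" for x r
  proof -
    obtain w where w: "w \<in> words" "x = code w" using x by (auto simp: carpet_eq)
    show ?thesis
    proof (cases "2 * r < 1")
      case True
      define k l where "k = level n (2 * r)" and "l = level m (2 * r)"
      have k: "2 * r \<le> 1 / real n ^ k" "1 / real n ^ k \<le> real n * (2 * r)"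
        and l: "2 * r \<le> 1 / real m ^ l" "1 / real m ^ l \<le> real m * (2 * r)" and kl: "k \<le> l"
        unfolding k_def l_def using True \<open>0 < r\<close> m_less_n
        by (intro power_level level_mono n_ge_2 m_ge_2; simp)+
      have l': "1 / real m ^ l \<le> real n * (2 * r)"
        using order_trans[OF l(2) mult_right_mono, of "real n"] m_less_n \<open>0 < r\<close> by simp
      have "weight k l v \<le> real n ^ 3 * weight k l w" if v: "v \<in> words" "code v \<in> ball (code w) (2 * r)" for v
      proof -
        have "\<bar>snd (code v) - snd (code w)\<bar> \<le> 1 / real m ^ l"
          using abs_fst_snd_le_dist(2)[of "code v" "code w"] v(2) l(1) by (simp add: dist_commute)
        moreover have self_near: "\<bar>snd (code w) - snd (code w)\<bar> \<le> 1 / real m ^ l" by simp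
        ultimately obtain s where "weight k l v \<le> real n ^ 3 * gain ^ s * weight k l w"
            "0 < s \<longrightarrow> 0 < fiber_count D (m - 1) \<and> (\<exists>j. 0 < fiber_count D j \<and> 0 < fiber_count D (Suc j))"
          using weight_compare[OF w(1) v(1) w(1) kl _ self_near] by blast
        moreover from this(2) have "s = 0" using no_carry by blast
        ultimately show ?thesis by simp
      qed
      then have "measure bernoulli (ball x (2 * r) \<inter> carpet n m D)
          \<le> C * real n ^ 3 * measure bernoulli (ball x (1 / 2 * (2 * r)) \<inter> carpet n m D)"
        unfolding w(2) using w(1) k l l' kl \<open>0 < r\<close> by (intro compare) auto
      also have "\<dots> \<le> ?K * measure bernoulli (ball x r \<inter> carpet n m D)"
        by (simp add: mult_right_mono)
      finally show ?thesis .
    next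
      case False
      \<comment> \<open>For \<open>2 * r \<ge> 1\<close> a square of fixed generation suffices: at
        \<open>k = l = 3\<close> its two sides add up to at most
        \<open>2 / 8 < 1 / 2 \<le> r\<close>.\<close>
      have "1 / real n ^ 3 \<le> 1 / real 2 ^ 3" "1 / real m ^ 3 \<le> 1 / real 2 ^ 3"
        using n_ge_2 m_ge_2 by (intro divide_left_mono power_mono; simp)+
      then have "1 / real n ^ 3 + 1 / real m ^ 3 < r" using False by simp
      then have "weight 3 3 w \<le> measure bernoulli (ball x r \<inter> carpet n m D)"
        unfolding w(2) by (intro measure_ball_ge_weight w) auto
      moreover have "weight 3 3 w = 1 / real (card D) ^ 3" by (simp add: weight_def)
      ultimately have "1 \<le> real (card D) ^ 3 * measure bernoulli (ball x r \<inter> carpet n m D)"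
        using card_D_pos by (simp add: field_simps)
      also have "\<dots> \<le> ?K * measure bernoulli (ball x r \<inter> carpet n m D)"
        by (simp add: mult_right_mono)
      finally show ?thesis using order_trans[OF \<mu>.prob_le_1] by blast
    qed
  qed
  then show ?thesis by (rule doubling_measure_bernoulli)
qed

section \<open>Runs of digits and horizontal grid lines\<close>

lemma near_grid_line_if_boundary_run:
  assumes w: "w \<in> words" and "s \<le> p" and run: "boundary_run w (p - s) p"
  shows "\<exists>b::nat. \<bar>snd (code w) - real b / real m ^ (p - s)\<bar> \<le> 1 / real m ^ p"
proof -
  define a where "a = p - s"
  then have p: "p = a + s" using \<open>s \<le> p\<close> by simp
  define u where "u = (\<lambda>t. snd (w (t + a)))"
  have u: "u t < m" for t using word_bounds[OF w] by (simp add: u_def)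
  let ?Y = "prefix_value m (\<lambda>t. snd (w t)) a"
  have y: "snd (code w) = (real ?Y + expansion m u) / real m ^ a"
    using expansion_split[OF m_ge_2, of "\<lambda>t. snd (w t)" a] word_bounds[OF w] by (simp add: code_def u_def)
  have e: "0 \<le> expansion m u" "expansion m u \<le> 1" using expansion_bounds[OF m_ge_2 u] by auto
  consider "\<And>t. t < s \<Longrightarrow> u t = 0" | "\<And>t. t < s \<Longrightarrow> u t = m - 1"
    using run unfolding boundary_run_def p u_def by fastforce
  then have "\<exists>b::nat. \<bar>real ?Y + expansion m u - real b\<bar> \<le> 1 / real m ^ s"
  proof cases
    case 1
    then have "expansion m u \<le> 1 / real m ^ s" using m_ge_2 u by (intro expansion_le_if_zeros)
    then show ?thesis using e by (intro exI[of _ ?Y]) simp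
  next
    case 2
    then have "1 - 1 / real m ^ s \<le> expansion m u" using m_ge_2 u by (intro expansion_ge_if_max)
    then show ?thesis using e by (intro exI[of _ "?Y + 1"]) simp
  qed
  then obtain b :: nat where b: "\<bar>real ?Y + expansion m u - real b\<bar> \<le> 1 / real m ^ s" by blast
  have "\<bar>snd (code w) - real b / real m ^ a\<bar> = \<bar>real ?Y + expansion m u - real b\<bar> / real m ^ a"
    unfolding y by (simp add: diff_divide_distrib[symmetric] abs_divide)
  also have "\<dots> \<le> 1 / real m ^ s / real m ^ a" using b by (intro divide_right_mono) auto
  also have "\<dots> = 1 / real m ^ p" by (simp add: p power_add mult.commute)
  finally show ?thesis unfolding a_def by blast
qed

text \<open>One digit is lost: at distance exactly \<open>1 / m ^ p\<close> from the line the digit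
  at \<open>p - 1\<close> may already deviate, whereas being closer than
  \<open>1 / m ^ (p - 1)\<close> determines all digits from \<open>p - s\<close> up to
  \<open>p - 2\<close>.\<close>

lemma boundary_run_if_near_grid_line:
  assumes w: "w \<in> words" and "s \<le> p" and near: "\<bar>snd (code w) - real (b::nat) / real m ^ (p - s)\<bar> \<le> 1 / real m ^ p"
  shows "boundary_run w (p - s) (p - 1)"
proof (cases s)
  case 0
  then show ?thesis by (simp add: boundary_run_def)
next
  case (Suc s')
  define a where "a = p - s"
  then have p: "p = a + s" using \<open>s \<le> p\<close> by simp
  define u where "u = (\<lambda>t. snd (w (t + a)))"
  have u: "u t < m" for t using word_bounds[OF w] by (simp add: u_def)
  let ?Y = "prefix_value m (\<lambda>t. snd (w t)) a"
  have y: "snd (code w) = (real ?Y + expansion m u) / real m ^ a"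
    using expansion_split[OF m_ge_2, of "\<lambda>t. snd (w t)" a] word_bounds[OF w] by (simp add: code_def u_def)
  have e: "0 \<le> expansion m u" "expansion m u \<le> 1" using expansion_bounds[OF m_ge_2 u] by auto
  have "\<bar>snd (code w) - real b / real m ^ a\<bar> = \<bar>real ?Y + expansion m u - real b\<bar> / real m ^ a"
    unfolding y by (simp add: diff_divide_distrib[symmetric] abs_divide)
  with near have "\<bar>real ?Y + expansion m u - real b\<bar> / real m ^ a \<le> 1 / real m ^ s / real m ^ a"
    by (simp add: a_def[symmetric] p power_add mult.commute)
  then have b: "\<bar>real ?Y + expansion m u - real b\<bar> \<le> 1 / real m ^ s"
    using m_ge_2 by (simp only: divide_le_cancel) (simp add: not_less)
  have small: "1 / real m ^ s < 1 / real m ^ s'"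
    using m_ge_2 by (simp add: Suc field_simps)
  have "1 / real m ^ s \<le> 1 / 2 ^ 1"
    using m_ge_2 Suc by (intro frac_le order_trans[OF power_mono[of 2 "real m" 1]] power_increasing) auto
  \<comment> \<open>At distance at most 1/2 from a number between \<open>?Y\<close> and
    \<open>?Y + 1\<close>, the integer \<open>b\<close> can only be one of these two ends.\<close>
  then have "real b < real (?Y + 2)" "real ?Y < real (b + 1)" using b e by auto
  then have "b = ?Y \<or> b = ?Y + 1" by linarith
  then have "(\<forall>t<s'. u t = 0) \<or> (\<forall>t<s'. u t = m - 1)"
  proof
    assume "b = ?Y"
    then have "expansion m u < 1 / real m ^ s'" using b small by simp
    then have "u t = 0" if "t < s'" for t
      using zeros_if_expansion_less[of m u s' t] m_ge_2 u that by simp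
    then show ?thesis by simp
  next
    assume "b = ?Y + 1"
    then have "1 - 1 / real m ^ s' < expansion m u" using b small by simp
    then have "u t = m - 1" if "t < s'" for t
      using max_if_expansion_greater[of m u s' t] m_ge_2 u that by simp
    then show ?thesis by simp
  qed
  moreover have "snd (w i) = u (i - a) \<and> i - a < s'" if "i \<in> {p - s..<p - 1}" for i
    using that Suc by (auto simp: u_def p)
  ultimately show ?thesis unfolding boundary_run_def by metis
qed

text \<open>For \<open>s \<le> p\<close> and up to one digit this is the event of a run of length
  \<open>s\<close> ending at \<open>p\<close>, expressed by the point instead of the word and Borel
  by construction.\<close>

definition near_grid :: "nat \<Rightarrow> nat \<Rightarrow> (real \<times> real) set" where
  "near_grid p s = (\<Union>b::nat. {z. \<bar>snd z - real b / real m ^ (p - s)\<bar> \<le> 1 / real m ^ p})"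

lemma near_grid_sets [measurable]: "near_grid p s \<in> sets borel"
proof -
  have "closed {z::real \<times> real. \<bar>snd z - c\<bar> \<le> d}" for c d
    by (intro closed_Collect_le continuous_intros)
  then show ?thesis unfolding near_grid_def by (intro sets.countable_UN) auto
qed

text \<open>The nonempty row \<open>m - 1\<close> takes a share of \<open>D\<close> away from row 0.
  This strict inequality is what makes the Borel-Cantelli series converge.\<close>

lemma fiber_ratio_less_1:
  assumes "0 < fiber_count D (m - 1)"
  shows "real (fiber_count D 0) / real (card D) < 1"
proof -
  obtain i where "(i, m - 1) \<in> D" using assms by (auto simp: fiber_count_pos_iff)
  moreover have "(i, m - 1) \<notin> D \<inter> {d. snd d = 0}" using m_ge_2 by simp
  ultimately have "D \<inter> {d. snd d = 0} \<subset> D" by blast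
  then have "fiber_count D 0 < card D" using psubset_card_mono[OF finite_D] card_fiber by metis
  then show ?thesis by simp
qed

text \<open>Row digits are independent, and row 0 is the likelier of the two boundary rows, hence
  the factor 2.\<close>

lemma measure_boundary_run_le:
  "measure word_measure {w. boundary_run w c d} \<le> 2 * (real (fiber_count D 0) / real (card D)) ^ (d - c)"
proof -
  let ?R = "\<lambda>j. {w. \<forall>i\<in>{c..<d}. w i \<in> {d. snd d = j}}"
  have sets: "?R j \<in> sets word_measure" for j
  proof -
    have "{w \<in> space word_measure. \<forall>i\<in>{c..<d}. w i \<in> {d. snd d = j}} \<in> sets word_measure" by measurable
    then show ?thesis by simp
  qed
  have meas: "measure word_measure (?R j) = (real (fiber_count D j) / real (card D)) ^ (d - c)" for j
  proof -
    have "emeasure word_measure (?R j) = (\<Prod>i\<in>{c..<d}. emeasure (measure_pmf (pmf_of_set D)) {d. snd d = j})"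
      using W.emeasure_PiM_Collect[of "{c..<d}" "\<lambda>_. {d. snd d = j}"] by simp
    also have "\<dots> = ennreal ((real (fiber_count D j) / real (card D)) ^ (d - c))"
      by (simp add: measure_pmf.emeasure_eq_measure measure_pmf_of_set[OF D_nonempty finite_D] card_fiber ennreal_power)
    finally show ?thesis by (simp add: measure_def)
  qed
  have "{w. boundary_run w c d} = ?R 0 \<union> ?R (m - 1)" by (auto simp: boundary_run_def)
  then have "measure word_measure {w. boundary_run w c d} \<le> measure word_measure (?R 0) + measure word_measure (?R (m - 1))"
    using sets by (simp add: measure_Un_le)
  also have "\<dots> \<le> 2 * (real (fiber_count D 0) / real (card D)) ^ (d - c)"
    unfolding meas using fiber_less by (simp add: power_mono divide_right_mono)
  finally show ?thesis .
qed

lemma measurable_boundary_run: "{w. boundary_run w c d} \<in> sets word_measure"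
proof -
  have "{w \<in> space word_measure. (\<forall>i\<in>{c..<d}. snd (w i) = 0) \<or> (\<forall>i\<in>{c..<d}. snd (w i) = m - 1)} \<in> sets word_measure"
    by measurable
  then show ?thesis by (simp add: boundary_run_def)
qed

lemma measure_near_grid_le:
  assumes "s \<le> p"
  shows "measure bernoulli (near_grid p s) \<le> 2 * (real (fiber_count D 0) / real (card D)) ^ (s - 1)"
proof -
  have "measure word_measure (code -` near_grid p s) \<le> measure word_measure {w. boundary_run w (p - s) (p - 1)}"
    using AE_words boundary_run_if_near_grid_line[OF _ assms] measurable_boundary_run
    by (intro W.P.finite_measure_mono_AE) (auto simp: near_grid_def elim!: eventually_mono)
  also have "\<dots> \<le> 2 * (real (fiber_count D 0) / real (card D)) ^ (p - 1 - (p - s))"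
    by (rule measure_boundary_run_le)
  also have "p - 1 - (p - s) = s - 1" using assms by simp
  finally show ?thesis by (simp add: measure_bernoulli)
qed

end

section \<open>Estimates of the doubling index\<close>

locale nondoubling_mcmullen = asymmetric_mcmullen +
  assumes fiber_top_pos: "0 < fiber_count D (m - 1)"
    and adjacent_fibers: "\<exists>j. 0 < fiber_count D j \<and> 0 < fiber_count D (Suc j)"
begin

abbreviation "index_quotient \<equiv> doubling_quotient (\<lambda>r. - ln r) (carpet n m D) bernoulli"
abbreviation "upper_index \<equiv> upper_doubling_index (\<lambda>r. - ln r) (carpet n m D) bernoulli"

lemma gain_eq: "gain = real (fiber_count D 0) / real (fiber_count D (m - 1))"
  using fiber_top_pos by (simp add: gain_def)

lemma gain_gt_1: "1 < gain"
  using fiber_top_pos fiber_less by (simp add: gain_eq)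

text \<open>The centre of every admissible small ball lies in the large one, so
  \<open>measure_ball_compare_run\<close> bounds all terms of the supremum at once, with a constant
  independent of \<open>w\<close> and \<open>r\<close>.\<close>

lemma quotient_upper:
  assumes "0 < \<rho>"
  obtains C where "\<And>w r. \<lbrakk>w \<in> words; 0 < r; r < 1\<rbrakk> \<Longrightarrow>
    index_quotient \<rho> (code w) r \<le> ereal ((C + real (run_length (level n r) (level m r - 2) w) * ln gain) / - ln r)"
proof -
  obtain C where C: "0 < C" and
    "\<And>r k l w w'. \<lbrakk>w \<in> words; w' \<in> words; 0 < r; k \<le> l; r \<le> 1 / real n ^ k; r \<le> 1 / real m ^ l;
       1 / real n ^ k \<le> real n * r; 1 / real m ^ l \<le> real n * r; code w' \<in> ball (code w) r\<rbrakk> \<Longrightarrow>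
     measure bernoulli (ball (code w) r \<inter> carpet n m D)
       \<le> C * gain ^ run_length k (l - 2) w * measure bernoulli (ball (code w') (\<rho> * r) \<inter> carpet n m D)"
    using measure_ball_compare_run[OF assms] by blast
  note compare = this(2)
  have "index_quotient \<rho> (code w) r \<le> ereal ((ln C + real (run_length (level n r) (level m r - 2) w) * ln gain) / - ln r)"
    if w: "w \<in> words" and r: "0 < r" "r < 1" for w r
    unfolding doubling_quotient_def
  proof (rule SUP_least)
    fix z' assume "z' \<in> {z' \<in> carpet n m D. ball z' (\<rho> * r) \<inter> carpet n m D \<subseteq> ball (code w) r \<inter> carpet n m D}"
    then have z': "z' \<in> carpet n m D" "ball z' (\<rho> * r) \<inter> carpet n m D \<subseteq> ball (code w) r \<inter> carpet n m D" by auto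
    have "z' \<in> ball z' (\<rho> * r)" using assms r by simp
    then have in_ball: "z' \<in> ball (code w) r" using z' by blast
    obtain w' where w': "w' \<in> words" "z' = code w'" using z'(1) by (auto simp: carpet_eq)
    let ?s = "run_length (level n r) (level m r - 2) w"
    let ?M = "measure bernoulli (ball (code w) r \<inter> carpet n m D)"
    let ?M' = "measure bernoulli (ball z' (\<rho> * r) \<inter> carpet n m D)"
    have "1 / real m ^ level m r \<le> real n * r"
      using order_trans[OF power_level(2)[OF m_ge_2 r] mult_right_mono, of "real n"] m_less_n r by simp
    then have le: "?M \<le> C * gain ^ ?s * ?M'"
      unfolding w'(2) using w w' in_ball r m_less_n
      by (intro compare power_level n_ge_2 m_ge_2 level_mono) auto
    have M': "0 < ?M'" using assms r z'(1) by (intro measure_ball_pos) auto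
    have M: "0 < ?M" using r w by (intro measure_ball_pos) (auto simp: carpet_eq)
    have "?M / ?M' \<le> C * gain ^ ?s" using le M' by (simp add: pos_divide_le_eq)
    then have "ln (?M / ?M') \<le> ln (C * gain ^ ?s)"
      using M M' by (subst ln_le_cancel_iff) (auto intro!: mult_pos_pos C zero_less_power simp: gain_gt_1 order_less_trans[OF zero_less_one])
    also have "\<dots> = ln C + real ?s * ln gain"
      using C gain_gt_1 by (simp add: ln_mult ln_realpow)
    finally have "ln (?M / ?M') / - ln r \<le> (ln C + real ?s * ln gain) / - ln r"
      using r by (intro divide_right_mono) auto
    then show "ereal (ln (?M / ?M') / - ln r) \<le> ereal ((ln C + real ?s * ln gain) / - ln r)" by simp
  qed
  then show ?thesis by (rule that)
qed

text \<open>Since \<open>\<rho> < 1\<close>, the concentric ball is admissible, and its term is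
  already nonnegative.\<close>

lemma quotient_nonneg:
  assumes "0 < \<rho>" "\<rho> < 1" "z \<in> carpet n m D" "0 < r" "r < 1"
  shows "0 \<le> index_quotient \<rho> z r"
  unfolding doubling_quotient_def
proof (rule SUP_upper2)
  interpret \<mu>: prob_space bernoulli by (rule prob_space_bernoulli)
  have sub: "ball z (\<rho> * r) \<inter> carpet n m D \<subseteq> ball z r \<inter> carpet n m D"
    using subset_ball[of "\<rho> * r" r z] assms mult_right_mono[of \<rho> 1 r] by auto
  with assms show "z \<in> {z' \<in> carpet n m D. ball z' (\<rho> * r) \<inter> carpet n m D \<subseteq> ball z r \<inter> carpet n m D}" by simp
  have "measure bernoulli (ball z (\<rho> * r) \<inter> carpet n m D) \<le> measure bernoulli (ball z r \<inter> carpet n m D)"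
    using sub closed_carpet by (intro \<mu>.finite_measure_mono) auto
  moreover have "0 < measure bernoulli (ball z (\<rho> * r) \<inter> carpet n m D)"
    using assms by (intro measure_ball_pos) auto
  ultimately have "0 \<le> ln (measure bernoulli (ball z r \<inter> carpet n m D) / measure bernoulli (ball z (\<rho> * r) \<inter> carpet n m D))"
    by (intro ln_ge_zero) simp
  then show "0 \<le> ereal (ln (measure bernoulli (ball z r \<inter> carpet n m D) / measure bernoulli (ball z (\<rho> * r) \<inter> carpet n m D)) / - ln r)"
    using assms by (simp add: divide_nonneg_pos del: divide_minus_right)
qed

lemma eventually_small_radius: "\<forall>\<^sub>F r::real in at_right 0. 0 < r \<and> r < 1"
  using eventually_at_right_real[of 0 1] by simp

lemma lower_index_nonneg:
  assumes "0 < \<rho>" "\<rho> < 1" "z \<in> carpet n m D"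
  shows "0 \<le> lower_doubling_index (\<lambda>r. - ln r) (carpet n m D) bernoulli \<rho> z"
  unfolding lower_doubling_index_def
  by (rule Liminf_bounded, rule eventually_mono[OF eventually_small_radius]) (use quotient_nonneg assms in auto)

lemma lower_index_le_upper_index: "lower_doubling_index (\<lambda>r. - ln r) (carpet n m D) bernoulli \<rho> z \<le> upper_index \<rho> z"
  unfolding lower_doubling_index_def upper_doubling_index_def by (rule Liminf_le_Limsup) simp

text \<open>Only the run length relative to \<open>- ln r\<close> matters: the constant of
  \<open>quotient_upper\<close> and \<open>B\<close> vanish after division, as \<open>- ln r\<close>
  tends to infinity.\<close>

lemma upper_index_le:
  assumes "0 < \<rho>" "w \<in> words"
    and ev: "\<forall>\<^sub>F r in at_right 0. real (run_length (level n r) (level m r - 2) w) * ln gain \<le> c * (- ln r) + B"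
  shows "upper_index \<rho> (code w) \<le> ereal c"
proof -
  obtain C where C: "\<And>w r. \<lbrakk>w \<in> words; 0 < r; r < 1\<rbrakk> \<Longrightarrow>
    index_quotient \<rho> (code w) r \<le> ereal ((C + real (run_length (level n r) (level m r - 2) w) * ln gain) / - ln r)"
    using quotient_upper[OF assms(1)] by blast
  let ?f = "\<lambda>r. (C + B) / (- ln r) + c"
  have "filterlim (\<lambda>r::real. - ln r) at_top (at_right 0)"
    using ln_at_0 by (simp add: filterlim_uminus_at_top)
  then have "((\<lambda>r. (C + B) / (- ln r)) \<longlongrightarrow> 0) (at_right 0)"
    by (rule real_tendsto_divide_at_top[OF tendsto_const])
  then have "(?f \<longlongrightarrow> 0 + c) (at_right 0)" by (intro tendsto_add tendsto_const)
  then have "Limsup (at_right 0) (\<lambda>r. ereal (?f r)) = ereal c"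
    by (intro lim_imp_Limsup) (simp_all add: trivial_limit_at_right_real)
  moreover have "Limsup (at_right 0) (index_quotient \<rho> (code w)) \<le> Limsup (at_right 0) (\<lambda>r. ereal (?f r))"
  proof (rule Limsup_mono)
    show "\<forall>\<^sub>F r in at_right 0. index_quotient \<rho> (code w) r \<le> ereal (?f r)"
      using ev eventually_small_radius
    proof eventually_elim
      case (elim r)
      then have "0 < - ln r" by simp
      have "(C + real (run_length (level n r) (level m r - 2) w) * ln gain) / - ln r
          \<le> (C + (c * (- ln r) + B)) / - ln r"
        using elim(1) \<open>0 < - ln r\<close> by (intro divide_right_mono add_left_mono) auto
      also have "\<dots> = ?f r" using \<open>0 < - ln r\<close> by (simp add: field_simps)
      finally show ?case using order_trans[OF C[OF assms(2), of r]] elim(2) by simp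
    qed
  qed
  ultimately show ?thesis by (simp add: upper_doubling_index_def)
qed

text \<open>The coefficient is the asymptotic length of the window \<open>l - k\<close> per unit of
  \<open>- ln r\<close>, so \<open>delta_max\<close> is the exponent produced by a run that fills
  the window.\<close>

lemma delta_max_eq: "delta_max n m D = (1 / ln (real m) - 1 / ln (real n)) * ln gain"
proof -
  have "0 < ln (real m)" "0 < ln (real n)" using m_ge_2 n_ge_2 by auto
  then have "inverse (ln (real n)) * (ln (real n) / ln (real m) - 1) = 1 / ln (real m) - 1 / ln (real n)"
    by (simp add: field_simps)
  then show ?thesis by (simp add: delta_max_def carpet_sigma_def gain_eq)
qed

lemma upper_index_le_delta_max:
  assumes "0 < \<rho>" "w \<in> words"
  shows "upper_index \<rho> (code w) \<le> ereal (delta_max n m D)"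
proof (rule upper_index_le[OF assms])
  show "\<forall>\<^sub>F r in at_right 0. real (run_length (level n r) (level m r - 2) w) * ln gain
      \<le> delta_max n m D * (- ln r) + ln gain"
    using eventually_small_radius
  proof eventually_elim
    case (elim r)
    have "run_length (level n r) (level m r - 2) w \<le> level m r - 2 - level n r" by (rule run_length_le)
    moreover have "level n r \<le> level m r" using elim m_less_n m_ge_2 by (intro level_mono) auto
    ultimately have "real (run_length (level n r) (level m r - 2) w) \<le> real (level m r) - real (level n r)" by linarith
    also have "\<dots> \<le> (- ln r / ln (real m)) - (- ln r / ln (real n) - 1)"
      using level_bounds(1)[OF m_ge_2, of r] level_bounds(2)[OF n_ge_2, of r] elim by linarith
    finally have "real (run_length (level n r) (level m r - 2) w) * ln gain
      \<le> ((- ln r / ln (real m)) - (- ln r / ln (real n) - 1)) * ln gain"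
      using gain_gt_1 by (intro mult_right_mono) auto
    also have "\<dots> = delta_max n m D * (- ln r) + ln gain"
      by (simp add: delta_max_eq algebra_simps)
    finally show ?case .
  qed
qed

section \<open>The almost sure value\<close>

lemma summable_near_grid:
  assumes "0 < q"
  shows "summable (\<lambda>p. measure bernoulli (near_grid p (p div q)))"
proof (rule summable_comparison_test)
  define \<theta> where "\<theta> = real (fiber_count D 0) / real (card D)"
  have \<theta>: "0 < \<theta>" "\<theta> < 1"
    using fiber_less card_D_pos fiber_ratio_less_1[OF fiber_top_pos] by (auto simp: \<theta>_def)
  have "measure bernoulli (near_grid p (p div q)) \<le> 2 * \<theta> powr - 2 * (\<theta> powr (1 / real q)) ^ p" for p
  proof -
    have "real p < real q * (real (p div q) + 1)"
    proof -
      have "p < q * (p div q + 1)" using assms dividend_less_times_div[of q p] by simp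
      then have "real p < real (q * (p div q + 1))" by (simp only: of_nat_less_iff)
      then show ?thesis by (simp add: algebra_simps)
    qed
    then have "real p / real q < real (p div q) + 1"
      using assms by (simp add: pos_divide_less_eq mult.commute)
    moreover have "real (p div q) - 1 \<le> real (p div q - 1)" by linarith
    \<comment> \<open>One lost unit is the rounding of \<open>p div q\<close>, the other the digit
      given up by the grid strips.\<close>
    ultimately have "real p / real q - 2 \<le> real (p div q - 1)" by linarith
    then have "\<theta> powr real (p div q - 1) \<le> \<theta> powr (real p / real q - 2)"
      using \<theta> by (intro powr_mono') auto
    also have "\<dots> = \<theta> powr - 2 * \<theta> powr (real p / real q)"
      by (simp add: powr_add[symmetric])
    also have "\<theta> powr (real p / real q) = (\<theta> powr (1 / real q)) powr real p"
      by (simp add: powr_powr)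
    also have "\<dots> = (\<theta> powr (1 / real q)) ^ p"
      using \<theta> by (intro powr_realpow) simp
    finally show ?thesis
      using measure_near_grid_le[of "p div q" p] \<theta> by (simp add: \<theta>_def[symmetric] powr_realpow)
  qed
  then show "\<exists>N. \<forall>p\<ge>N. norm (measure bernoulli (near_grid p (p div q))) \<le> 2 * \<theta> powr - 2 * (\<theta> powr (1 / real q)) ^ p"
    by simp
  have "\<theta> powr (1 / real q) < 1" using \<theta> assms by (simp add: powr01_less_one)
  then show "summable (\<lambda>p. 2 * \<theta> powr - 2 * (\<theta> powr (1 / real q)) ^ p)"
    by (intro summable_mult summable_geometric) auto
qed

text \<open>For each \<open>q\<close>, Borel-Cantelli bounds all late runs ending at
  \<open>p\<close> by \<open>p div Suc q\<close>, hence the index by a multiple of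
  \<open>1 / Suc q\<close>. Countably many \<open>q\<close> push it to 0 on one set of full
  measure.\<close>

lemma AE_has_doubling_index_zero:
  assumes "0 < \<rho>" "\<rho> < 1"
  shows "AE z in bernoulli. z \<in> carpet n m D \<longrightarrow> has_doubling_index (\<lambda>r. - ln r) (carpet n m D) bernoulli \<rho> z 0"
proof -
  interpret \<mu>: prob_space bernoulli by (rule prob_space_bernoulli)
  have "AE z in bernoulli. \<forall>\<^sub>F p in sequentially. z \<in> space bernoulli - near_grid p (p div Suc q)" for q
    using summable_near_grid[of "Suc q"] by (intro borel_cantelli_AE1) (simp_all add: \<mu>.emeasure_eq_measure)
  then have "AE z in bernoulli. \<forall>q. \<forall>\<^sub>F p in sequentially. z \<in> space bernoulli - near_grid p (p div Suc q)"
    by (simp add: AE_all_countable)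
  then show ?thesis
  proof eventually_elim
    case (elim z)
    show ?case
    proof
      assume z: "z \<in> carpet n m D"
      then obtain w where w: "w \<in> words" "z = code w" by (auto simp: carpet_eq)
      let ?c = "\<lambda>q. ln gain / ln (real m) * (1 / real (Suc q))"
      have "upper_index \<rho> z \<le> ereal (?c q)" for q :: nat
        unfolding w(2)
      proof (rule upper_index_le[OF assms(1) w(1)])
        \<comment> \<open>The strips do not depend on where the window starts, and a longer run
          contains one of exactly this length ending at \<open>p\<close>; so the bound holds for all
          \<open>k\<close> at once.\<close>
        have short_runs: "\<forall>\<^sub>F p in sequentially. \<forall>k. run_length k p w \<le> p div Suc q"
        proof -
          have "\<forall>\<^sub>F p in sequentially. z \<notin> near_grid p (p div Suc q)"
            using elim by (auto elim: eventually_mono)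
          then show ?thesis
          proof eventually_elim
            case (elim p)
            have False if *: "\<not> run_length k p w \<le> p div Suc q" for k
            proof -
              have "boundary_run w (p - p div Suc q) p"
                using * boundary_run_run_length[of w p k] by (auto simp: boundary_run_def)
              then show False
                using near_grid_line_if_boundary_run[OF w(1), of "p div Suc q" p] elim w(2)
                by (auto simp: near_grid_def)
            qed
            then show ?case by blast
          qed
        qed
        show "\<forall>\<^sub>F r in at_right 0. real (run_length (level n r) (level m r - 2) w) * ln gain \<le> ?c q * (- ln r) + 0"
          using eventually_compose_filterlim[OF short_runs
              filterlim_compose[OF filterlim_minus_const_nat_at_top[of 2] filterlim_level[OF m_ge_2]]] eventually_small_radius
        proof eventually_elim
          case (elim r)
          let ?p = "level m r - 2"
          have "real (run_length (level n r) ?p w) \<le> real (?p div Suc q)"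
            using elim(1) by (intro of_nat_mono) blast
          also have "\<dots> \<le> real ?p / real (Suc q)"
            by (rule of_nat_div_le_of_nat)
          also have "\<dots> \<le> (- ln r / ln (real m)) / real (Suc q)"
            using level_bounds(1)[OF m_ge_2, of r] elim by (intro divide_right_mono) linarith+
          finally have "real (run_length (level n r) ?p w) \<le> (- ln r / ln (real m)) / real (Suc q)" .
          then have "real (run_length (level n r) ?p w) * ln gain \<le> (- ln r / ln (real m)) / real (Suc q) * ln gain"
            using gain_gt_1 by (intro mult_right_mono) auto
          also have "\<dots> = ?c q * (- ln r) + 0" by simp
          finally show ?case .
        qed
      qed
      moreover have "(\<lambda>q. ereal (?c q)) \<longlonglongrightarrow> ereal (ln gain / ln (real m) * 0)"
        by (intro tendsto_intros LIMSEQ_Suc[OF lim_1_over_n])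
      ultimately have "upper_index \<rho> z \<le> 0"
        by (intro LIMSEQ_le_const[of "\<lambda>q. ereal (?c q)"]) (auto simp: zero_ereal_def)
      note bounds = lower_index_nonneg[OF assms z] lower_index_le_upper_index[of \<rho> z]
      show "has_doubling_index (\<lambda>r. - ln r) (carpet n m D) bernoulli \<rho> z 0"
        unfolding has_doubling_index_def
      proof
        show "lower_doubling_index (\<lambda>r. - ln r) (carpet n m D) bernoulli \<rho> z = 0"
          by (rule antisym[OF order_trans[OF bounds(2) \<open>upper_index \<rho> z \<le> 0\<close>] bounds(1)])
        show "upper_index \<rho> z = 0"
          by (rule antisym[OF \<open>upper_index \<rho> z \<le> 0\<close> order_trans[OF bounds]])
      qed
    qed
  qed
qed

section \<open>Points with prescribed doubling index\<close>

lemma level_le_if_power_le: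
  assumes "2 \<le> b" "0 < r" "r < 1" "1 / real b ^ j \<le> r"
  shows "level b r \<le> j"
proof -
  have "1 / real b ^ j \<le> 1 / real b ^ level b r"
    using assms power_level(1)[of b r] by linarith
  then have "real b ^ level b r \<le> real b ^ j"
    using assms(1) by (simp add: divide_le_cancel field_simps)
  then show ?thesis using assms(1) by simp
qed

text \<open>
  The word \<open>w\<close> passes just above a grid line of generation \<open>q\<close>, followed by a run of zeros up to \<open>e\<close>.
  At scale \<open>m\<^sup>-\<^sup>e\<close> the ball around its point also sees the strip below the line, where
  the rows carry a run of the digit \<open>m - 1\<close> instead.
\<close>

lemma quotient_lower:
  assumes "0 < \<rho>" "\<rho> \<le> 1 / 27"
  obtains C where "\<And>w q e. \<lbrakk>w \<in> words; 1 \<le> q; q < e; 3 \<le> e; snd (w (q - 1)) = Suc j; 0 < fiber_count D j;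
      \<And>t. q \<le> t \<Longrightarrow> t < e \<Longrightarrow> snd (w t) = 0; 1 / real n ^ (q - 1) \<le> 1 / real m ^ e\<rbrakk> \<Longrightarrow>
    ereal ((real (e - q) * ln gain - C) / - ln (4 / real m ^ e)) \<le> index_quotient \<rho> (code w) (4 / real m ^ e)"
proof -
  obtain C where C: "0 < C" and
    "\<And>r k l w. \<lbrakk>w \<in> words; 0 < r; k \<le> l; 1 / real n ^ k \<le> real n * r; 1 / real m ^ l \<le> real n * r\<rbrakk> \<Longrightarrow>
     weight k l w \<le> C * measure bernoulli (ball (code w) (1 * r) \<inter> carpet n m D)"
    using weight_le_measure_ball[of 1] by (metis zero_less_one)
  note lower = this(2)
  define C' where "C' = ln (9 * C * real n ^ 3 * gain ^ 3)"
  have C_pos: "0 < 9 * C * real n ^ 3 * gain ^ 3" using C gain_pos n_ge_2 by simp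
  have "ereal ((real (e - q) * ln gain - C') / - ln (4 / real m ^ e)) \<le> index_quotient \<rho> (code w) (4 / real m ^ e)"
    if w: "w \<in> words" and q: "1 \<le> q" "q < e" "3 \<le> e" and dig: "snd (w (q - 1)) = Suc j" and j: "0 < fiber_count D j"
      and zeros: "\<And>t. q \<le> t \<Longrightarrow> t < e \<Longrightarrow> snd (w t) = 0" and e: "1 / real n ^ (q - 1) \<le> 1 / real m ^ e" for w q e
  proof -
    \<comment> \<open>In units of \<open>1 / m ^ e\<close>: \<open>w\<close> is at most 1 above the
      line, the comparison word is exactly 1 below it, and horizontally they differ by at most 1.
      Radius 4 leaves one unit for the small ball.\<close>
    define r where "r = 4 / real m ^ e"
    have "real 2 ^ 3 \<le> real m ^ e"
      using m_ge_2 q by (intro order_trans[OF power_mono[of "real 2" "real m" 3] power_increasing]) auto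
    then have r: "0 < r" "r < 1" using m_ge_2 by (auto simp: r_def)
    define k l where "k = level n r" and "l = level m r"
    have kl: "k \<le> l" unfolding k_def l_def using r m_less_n m_ge_2 by (intro level_mono) auto
    have k: "r \<le> 1 / real n ^ k" "1 / real n ^ k \<le> real n * r"
      and l: "r \<le> 1 / real m ^ l" "1 / real m ^ l \<le> real m * r"
      unfolding k_def l_def using r by (intro power_level n_ge_2 m_ge_2; simp)+
    have l': "1 / real m ^ l \<le> real n * r"
      using order_trans[OF l(2) mult_right_mono, of "real n"] m_less_n r by simp
    \<comment> \<open>This places the run entirely after the column scale, so that its positions
      below \<open>l\<close> all count in the weight.\<close>
    have kq: "k \<le> q - 1"
      unfolding k_def
    proof (rule level_le_if_power_le[OF n_ge_2 r])
      have "1 / real m ^ e \<le> r" unfolding r_def by (intro divide_right_mono) auto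
      with e show "1 / real n ^ (q - 1) \<le> r" by linarith
    qed
    have le: "l \<le> e - 1"
    proof -
      have "1 / real m ^ e < r" unfolding r_def using m_ge_2 by (intro divide_strict_right_mono) auto
      then have "1 / real m ^ e < 1 / real m ^ l" using l(1) by linarith
      then have "real m ^ l < real m ^ e" using m_ge_2 by (simp add: field_simps)
      then show ?thesis using m_ge_2 by simp
    qed
    have el: "e \<le> l + 3"
    proof -
      have "real m ^ e \<le> real m ^ (l + 1) * 2 ^ 2"
        using l(2) m_ge_2 by (simp add: r_def field_simps)
      also have "\<dots> \<le> real m ^ (l + 1) * real m ^ 2"
        using m_ge_2 by (intro mult_left_mono power_mono) auto
      also have "\<dots> = real m ^ (l + 3)" by (simp add: power_add power2_eq_square power3_eq_cube)
      finally show ?thesis using m_ge_2 by simp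
    qed
    obtain i0 where i0: "(i0, j) \<in> D" using j by (auto simp: fiber_count_pos_iff)
    obtain i1 where i1: "(i1, m - 1) \<in> D" using fiber_top_pos by (auto simp: fiber_count_pos_iff)
    obtain i2 where i2: "(i2, 0) \<in> D" using fiber_less fiber_count_pos_iff[of 0] by auto
    \<comment> \<open>The digit at \<open>q - 1\<close> is lowered by one and followed by a run of
      \<open>m - 1\<close>. The zeros from \<open>e\<close> on put the point at height exactly
      \<open>1 / m ^ e\<close> below the line.\<close>
    define v where "v t = (if t < q - 1 then w t else if t = q - 1 then (i0, j) else if t < e then (i1, m - 1) else (i2, 0))" for t
    have v: "v \<in> words" using w i0 i1 i2 by (auto simp: words_def v_def)
    let ?Y = "\<lambda>x. prefix_value m (\<lambda>t. snd (x t))"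
    have Yq: "?Y w q = ?Y v q + 1"
    proof -
      have "?Y w (q - 1) = ?Y v (q - 1)" by (rule prefix_value_cong) (simp add: v_def)
      then have "?Y w (Suc (q - 1)) = ?Y v (Suc (q - 1)) + 1" using dig by (simp add: v_def)
      then show ?thesis using q by simp
    qed
    define \<Lambda> where "\<Lambda> = real (?Y w q) / real m ^ q"
    have split_e: "1 / real m ^ e = 1 / real m ^ (e - q) / real m ^ q"
      using q by (simp add: power_add[symmetric])
    have yw: "\<Lambda> \<le> snd (code w)" "snd (code w) \<le> \<Lambda> + 1 / real m ^ e"
    proof -
      let ?x = "expansion m (\<lambda>t. snd (w (t + q)))"
      have eq: "snd (code w) = \<Lambda> + ?x / real m ^ q"
        unfolding code_def snd_conv \<Lambda>_def
        by (subst expansion_split[OF m_ge_2, of _ q]) (use word_bounds[OF w] in \<open>auto simp: add_divide_distrib\<close>)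
      have "0 \<le> ?x" using word_bounds[OF w] by (intro expansion_bounds m_ge_2)
      then show "\<Lambda> \<le> snd (code w)" using eq by simp
      have "?x \<le> 1 / real m ^ (e - q)"
        using word_bounds[OF w] zeros by (intro expansion_le_if_zeros m_ge_2) auto
      then show "snd (code w) \<le> \<Lambda> + 1 / real m ^ e"
        unfolding eq split_e by (intro add_left_mono divide_right_mono) auto
    qed
    have yv: "snd (code v) = \<Lambda> - 1 / real m ^ e"
    proof -
      let ?u = "\<lambda>t. snd (v (t + q))"
      have "prefix_value m ?u (e - q) = prefix_value m (\<lambda>_. m - 1) (e - q)"
        using q by (intro prefix_value_cong) (auto simp: v_def)
      then have pre: "real (prefix_value m ?u (e - q)) = real m ^ (e - q) - 1"
        using prefix_value_max[of m "e - q"] m_ge_2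
        by (metis One_nat_def Suc_leD add_diff_cancel_right' numeral_2_eq_2 of_nat_1 of_nat_add of_nat_power)
      have "(\<lambda>t. ?u (t + (e - q))) = (\<lambda>_. 0)" using q by (auto simp: v_def fun_eq_iff)
      moreover have "expansion m (\<lambda>_. 0) = 0" by (simp add: expansion_def)
      ultimately have "expansion m ?u = real (prefix_value m ?u (e - q)) / real m ^ (e - q)"
        using expansion_split[OF m_ge_2, of ?u "e - q"] word_bounds[OF v] by simp
      then have "expansion m ?u = 1 - 1 / real m ^ (e - q)"
        unfolding pre using m_ge_2 by (simp add: diff_divide_distrib)
      moreover have "snd (code v) = (real (?Y v q) + expansion m ?u) / real m ^ q"
        unfolding code_def snd_conv by (rule expansion_split[OF m_ge_2]) (use word_bounds[OF v] in auto)
      ultimately show ?thesis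
        unfolding \<Lambda>_def split_e Yq by (simp add: diff_divide_distrib add_divide_distrib)
    qed
    have dist: "dist (code w) (code v) \<le> 3 / real m ^ e"
    proof -
      have "\<bar>fst (code w) - fst (code v)\<bar> \<le> 1 / real n ^ (q - 1)"
        unfolding code_def fst_conv
        by (rule expansion_near[OF n_ge_2]) (use word_bounds[OF w] word_bounds[OF v] in \<open>auto simp: v_def\<close>)
      moreover have "\<bar>snd (code w) - snd (code v)\<bar> \<le> 2 / real m ^ e" using yw yv by (simp add: abs_le_iff)
      ultimately show ?thesis using dist_plane_le[of "code w" "code v"] e by simp
    qed
    have \<rho>r: "0 < \<rho> * r" "\<rho> * r \<le> 4 / 27 / real m ^ e"
      using assms r mult_right_mono[of \<rho> "1 / 27" r] by (auto simp: r_def)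
    have sub: "ball (code v) (\<rho> * r) \<inter> carpet n m D \<subseteq> ball (code w) r \<inter> carpet n m D"
    proof -
      have "3 / real m ^ e + \<rho> * r \<le> r"
        using \<rho>r(2) m_ge_2 by (simp add: r_def field_simps)
      then have "dist (code w) x < r" if "dist (code v) x < \<rho> * r" for x
        using dist dist_triangle[of "code w" x "code v"] that by linarith
      then show ?thesis by auto
    qed
    have f: "e - 1 = q + (e - 1 - q)" "e = Suc (e - 1)" using q by auto
    \<comment> \<open>The small ball lies strictly between the line and \<open>2 / m ^ e\<close>
      below it. As \<open>2 / m \<le> 1\<close>, this is inside a single grid row of generation
      \<open>e - 1\<close>, so every word coding into the ball shares the prefix of \<open>v\<close>
      and hence its weight.\<close>
    have prefix: "?Y u (e - 1) + 1 = ?Y w q * m ^ (e - 1 - q)" if u: "u \<in> words" "code u \<in> ball (code v) (\<rho> * r)" for u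
    proof -
      let ?f = "e - 1"
      have "\<bar>snd (code u) - snd (code v)\<bar> < 4 / 27 / real m ^ e"
        using abs_fst_snd_le_dist(2)[of "code u" "code v"] u(2) \<rho>r(2) by (simp add: dist_commute)
      then have y: "snd (code u) < \<Lambda>" "\<Lambda> - 2 / real m ^ e < snd (code u)"
        unfolding yv by (auto simp: abs_less_iff field_simps)
      have "real m ^ ?f * (2 / real m ^ e) \<le> 1"
        using m_ge_2 by (subst (2) f(2)) (simp add: field_simps)
      moreover have "real m ^ ?f * \<Lambda> = real (?Y w q * m ^ (?f - q))"
        unfolding \<Lambda>_def using m_ge_2 by (subst f(1)) (simp add: power_add)
      moreover have "real m ^ ?f * snd (code u) < real m ^ ?f * \<Lambda>"
        "real m ^ ?f * (\<Lambda> - 2 / real m ^ e) < real m ^ ?f * snd (code u)"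
        using y m_ge_2 by (intro mult_strict_left_mono; simp)+
      ultimately have "real m ^ ?f * snd (code u) < real (?Y w q * m ^ (?f - q))"
        "real (?Y w q * m ^ (?f - q)) - 1 < real m ^ ?f * snd (code u)"
        by (simp_all add: right_diff_distrib)
      moreover have "real (?Y u ?f) \<le> real m ^ ?f * snd (code u)" "real m ^ ?f * snd (code u) \<le> real (?Y u ?f) + 1"
        using prefix_value_bounds[OF m_ge_2, of "\<lambda>t. snd (u t)" ?f] word_bounds[OF u(1)] by (auto simp: code_def)
      ultimately have "real (?Y u ?f) < real (?Y w q * m ^ (?f - q))"
        "real (?Y w q * m ^ (?f - q)) < real (?Y u ?f + 2)" by simp_all
      then show ?thesis by (simp only: of_nat_less_iff)
    qed
    have same: "weight k l u = weight k l v" if u: "u \<in> words" "code u \<in> ball (code v) (\<rho> * r)" for u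
    proof -
      have "?Y u (e - 1) = ?Y v (e - 1)"
        using prefix[OF u] prefix[OF v] \<rho>r(1) by simp
      then have "snd (u t) = snd (v t)" if "t < e - 1" for t
        using prefix_value_eqD[of "\<lambda>t. snd (u t)" m "\<lambda>t. snd (v t)" "e - 1" t] that word_bounds[OF u(1)] word_bounds[OF v]
        by blast
      then show ?thesis unfolding weight_def using le by (intro arg_cong2[where f="(/)"] prod.cong) auto
    qed
    let ?M = "measure bernoulli (ball (code w) r \<inter> carpet n m D)"
    let ?M' = "measure bernoulli (ball (code v) (\<rho> * r) \<inter> carpet n m D)"
    have M': "?M' \<le> 9 * weight k l v"
    proof (rule measure_ball_le_weight[OF kl])
      have "\<rho> * r \<le> 1 * r" using assms r by (intro mult_right_mono) auto
      then show "\<rho> * r \<le> 1 / real n ^ k" "\<rho> * r \<le> 1 / real m ^ l" using k l by auto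
    qed (use same weight_pos[OF v, of k l] in auto)
    \<comment> \<open>Now the comparison runs downwards in size: each position of the run gains a
      factor \<open>1 / gain\<close>, and the only possible exception is the carry position
      \<open>q - 1\<close>.\<close>
    have "weight k l v \<le> real n ^ 3 * (1 / gain) ^ card {q..<l} * weight k l w"
    proof (rule weight_le_weight[where A="{q - 1} \<inter> {..<l}", OF v w])
      show "fiber_count D (snd (v t)) \<le> fiber_count D (snd (w t))"
        if "t < l" "k \<le> t" "t \<notin> {q - 1} \<inter> {..<l}" "t \<notin> {q..<l}" for t
        using that by (auto simp: v_def)
      show "real (fiber_count D (snd (v t))) \<le> 1 / gain * real (fiber_count D (snd (w t)))" if "t \<in> {q..<l}" for t
      proof -
        have "snd (v t) = m - 1" "snd (w t) = 0" using that le q zeros[of t] by (auto simp: v_def)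
        then show ?thesis using fiber_top_pos fiber_less by (simp add: gain_eq)
      qed
      show "card ({q - 1} \<inter> {..<l}) \<le> 3" using card_mono[of "{q - 1}" "{q - 1} \<inter> {..<l}"] by simp
    qed (use gain_pos kq q in auto)
    moreover have "weight k l w \<le> C * ?M"
      using lower[OF w r(1) kl k(2) l'] by simp
    ultimately have "weight k l v \<le> real n ^ 3 * (1 / gain) ^ (l - q) * (C * ?M)"
      using gain_pos by (simp del: power_one_over) (meson mult_left_mono order_trans zero_le_mult_iff zero_le_power of_nat_0_le_iff zero_le_divide_1_iff less_imp_le)
    then have "?M' \<le> 9 * (real n ^ 3 * (1 / gain) ^ (l - q) * (C * ?M))" using M' by linarith
    also have "\<dots> = 9 * C * real n ^ 3 * ?M / gain ^ (l - q)" by (simp add: power_divide)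
    finally have "?M' * gain ^ (l - q) \<le> 9 * C * real n ^ 3 * ?M"
      using gain_pos by (simp add: pos_le_divide_eq)
    then have "?M' * gain ^ (l - q) * gain ^ 3 \<le> 9 * C * real n ^ 3 * ?M * gain ^ 3"
      using gain_pos by (intro mult_right_mono) auto
    \<comment> \<open>Replacing \<open>l\<close> by \<open>e\<close> in the exponent costs at most
      \<open>gain ^ 3\<close>, because \<open>e \<le> l + 3\<close>.\<close>
    moreover have "gain ^ (e - q) \<le> gain ^ (l - q) * gain ^ 3"
      unfolding power_add[symmetric] using gain_gt_1 el by (intro power_increasing) auto
    ultimately have "?M' * gain ^ (e - q) \<le> 9 * C * real n ^ 3 * gain ^ 3 * ?M"
      using mult_left_mono[of "gain ^ (e - q)" "gain ^ (l - q) * gain ^ 3" ?M'] by (simp add: mult_ac)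
    moreover have M'_pos: "0 < ?M'" using \<rho>r v by (intro measure_ball_pos) (auto simp: carpet_eq)
    moreover have M_pos: "0 < ?M" using r w by (intro measure_ball_pos) (auto simp: carpet_eq)
    ultimately have "gain ^ (e - q) / (9 * C * real n ^ 3 * gain ^ 3) \<le> ?M / ?M'"
      using C_pos by (simp add: divide_simps mult_ac)
    then have "ln (gain ^ (e - q) / (9 * C * real n ^ 3 * gain ^ 3)) \<le> ln (?M / ?M')"
      using C_pos gain_pos M_pos M'_pos by (subst ln_le_cancel_iff) (auto intro!: divide_pos_pos)
    moreover have "ln (gain ^ (e - q) / (9 * C * real n ^ 3 * gain ^ 3)) = real (e - q) * ln gain - C'"
      unfolding C'_def using C_pos gain_pos by (subst ln_div) (auto simp: ln_realpow)
    ultimately have "(real (e - q) * ln gain - C') / - ln r \<le> ln (?M / ?M') / - ln r"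
      using r by (intro divide_right_mono) auto
    also have "ereal (ln (?M / ?M') / - ln r) \<le> index_quotient \<rho> (code w) r"
      unfolding doubling_quotient_def using v sub by (intro SUP_upper) (auto simp: carpet_eq)
    finally show ?thesis unfolding r_def by simp
  qed
  then show ?thesis by (rule that)
qed

text \<open>
  Runs of zeros of relative length \<open>1 - 1 / lam\<close> start at the powers of \<open>M\<close>, each preceded by
  the digit \<open>Suc j\<close>. Elsewhere zeros and \<open>m - 1\<close> alternate, so that no other run is long.
\<close>

definition sparse_row :: "nat \<Rightarrow> real \<Rightarrow> nat \<Rightarrow> nat \<Rightarrow> nat" where
  "sparse_row M lam j t =
     (if \<exists>i\<ge>1. Suc t = M ^ i then Suc j
      else if (\<exists>i\<ge>1. M ^ i \<le> t \<and> real t < lam * real (M ^ i)) \<or> even t then 0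
      else m - 1)"

text \<open>Powers of the odd number \<open>M\<close> are odd, so \<open>Suc j\<close> is placed at
  even positions only, and odd positions outside the zero blocks carry \<open>m - 1\<close> and
  break a run of zeros. A long run of zeros therefore ends inside or just after a block starting at
  some \<open>M ^ i\<close>, and the odd position \<open>M ^ i - 2\<close> stops it on the left: its
  length is below \<open>p - M ^ i + 2\<close>, where \<open>p < lam * M ^ i + 2\<close>.\<close>

lemma sparse_row_boundary_run:
  assumes M: "odd M" "5 \<le> M" "lam + 2 \<le> real M" and lam: "1 \<le> lam"
    and w: "\<And>t. snd (w t) = sparse_row M lam j t" and run: "boundary_run w a p"
  shows "real (p - a) \<le> (1 - 1 / lam) * real p + 8"
proof (cases "p - a \<le> 8")
  case True
  moreover have "0 \<le> (1 - 1 / lam) * real p" using lam by simp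
  ultimately show ?thesis by linarith
next
  case False
  have odd_pow: "odd (M ^ i)" for i using M(1) by simp
  have not_special: "\<not> (\<exists>i\<ge>1. Suc t = M ^ i)" if "odd t" for t
    using that odd_pow by (metis even_Suc)
  \<comment> \<open>A run of \<open>m - 1\<close> longer than 8 meets two even positions at distance
    2. Even positions are nonzero only just before a power of \<open>M\<close>, and two powers of
    \<open>M\<close> never differ by 2.\<close>
  have "\<forall>i\<in>{a..<p}. snd (w i) = 0"
  proof (rule ccontr)
    assume "\<not> (\<forall>i\<in>{a..<p}. snd (w i) = 0)"
    then have max: "\<And>i. a \<le> i \<Longrightarrow> i < p \<Longrightarrow> sparse_row M lam j i = m - 1"
      using run w by (auto simp: boundary_run_def)
    define t where "t = (if even a then a else Suc a)"
    have "even t" "a \<le> t" "t + 2 < p" using False by (auto simp: t_def)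
    then have "sparse_row M lam j t \<noteq> 0" "sparse_row M lam j (t + 2) \<noteq> 0"
      using max[of t] max[of "t + 2"] m_ge_2 by auto
    moreover have "\<exists>i. Suc s = M ^ i" if "even s" "sparse_row M lam j s \<noteq> 0" for s
      using that by (auto simp: sparse_row_def split: if_splits)
    ultimately obtain i i' where i: "Suc t = M ^ i" "Suc (t + 2) = M ^ i'"
      using \<open>even t\<close> by (metis even_add even_numeral)
    then have "M ^ i < M ^ i'" by linarith
    then have "M * M ^ i \<le> M ^ i'" using M(2) by (intro power_gap) simp_all
    moreover have "5 * M ^ i \<le> M * M ^ i" using M(2) by (intro mult_right_mono) auto
    ultimately show False using i by simp
  qed
  then have zero: "\<And>i. a \<le> i \<Longrightarrow> i < p \<Longrightarrow> sparse_row M lam j i = 0" using w by simp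
  define t where "t = (if odd (p - 1) then p - 1 else p - 2)"
  have t: "odd t" "a \<le> t" "t < p" "p \<le> t + 2" using False by (auto simp: t_def)
  obtain i where i: "1 \<le> i" "M ^ i \<le> t" "real t < lam * real (M ^ i)"
    using zero[OF t(2,3)] not_special[OF t(1)] t(1) m_ge_2 by (auto simp: sparse_row_def split: if_splits)
  have M5: "5 \<le> M ^ i" using self_le_power[of M i] M(2) i(1) by simp
  have "odd (M ^ i - 2)" using odd_pow[of i] M5 by simp
  \<comment> \<open>Lying in an earlier block would mean \<open>M ^ i - 2 < lam * M ^ i'\<close>
    with \<open>M * M ^ i' \<le> M ^ i\<close>, which \<open>lam + 2 \<le> M\<close>
    excludes.\<close>
  have "sparse_row M lam j (M ^ i - 2) \<noteq> 0"
  proof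
    assume "sparse_row M lam j (M ^ i - 2) = 0"
    then obtain i' where i': "M ^ i' \<le> M ^ i - 2" "real (M ^ i - 2) < lam * real (M ^ i')"
      using \<open>odd (M ^ i - 2)\<close> not_special[OF \<open>odd (M ^ i - 2)\<close>] m_ge_2
      by (auto simp: sparse_row_def split: if_splits)
    have "M ^ i' < M ^ i" using i'(1) M5 by linarith
    then have "M * M ^ i' \<le> M ^ i" using M(2) by (intro power_gap) simp_all
    then have "real M * real (M ^ i') \<le> real (M ^ i)" by (metis of_nat_le_iff of_nat_mult)
    moreover have "(lam + 2) * real (M ^ i') \<le> real M * real (M ^ i')"
      using M(3) by (intro mult_right_mono) auto
    moreover have "1 \<le> real (M ^ i')" using M(2) by simp
    moreover have "real (M ^ i - 2) = real (M ^ i) - 2" using M5 by (simp add: of_nat_diff)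
    ultimately show False using i'(2) by (simp add: distrib_right)
  qed
  then have "M ^ i - 2 < a" using zero[of "M ^ i - 2"] t i(2) M5 by (meson diff_le_self le_less_trans not_le order_trans)
  then have "real p - real (M ^ i) + 2 > real (p - a)" using M5 t i False by linarith
  moreover have "real p / lam - 2 < real (M ^ i)"
  proof -
    have "real p < lam * real (M ^ i) + 2" using i(3) t(4) by linarith
    also have "\<dots> \<le> lam * real (M ^ i) + 2 * lam" using lam by simp
    finally have "real p < (real (M ^ i) + 2) * lam" by (simp add: algebra_simps)
    then have "real p / lam < real (M ^ i) + 2" using lam by (simp add: pos_divide_less_eq)
    then show ?thesis by simp
  qed
  moreover have "(1 - 1 / lam) * real p = real p - real p / lam" by (simp add: left_diff_distrib)
  ultimately show ?thesis by linarith
qed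

text \<open>The next digit \<open>Suc j\<close> sits just before \<open>M * M ^ i\<close>, which is
  beyond the block because \<open>lam + 2 \<le> M\<close>.\<close>

lemma sparse_row_zeros:
  assumes M: "5 \<le> M" "lam + 2 \<le> real M" and "1 \<le> i" "M ^ i \<le> t" "real t < lam * real (M ^ i)"
  shows "sparse_row M lam j t = 0"
proof -
  have "\<not> (\<exists>i'\<ge>1. Suc t = M ^ i')"
  proof
    assume "\<exists>i'\<ge>1. Suc t = M ^ i'"
    then obtain i' where i': "Suc t = M ^ i'" by auto
    have "M ^ i < M ^ i'" using i' assms(4) by linarith
    then have "M * M ^ i \<le> M ^ i'" using M(1) by (intro power_gap) simp_all
    then have "real M * real (M ^ i) \<le> real (Suc t)" using i' by (metis of_nat_le_iff of_nat_mult)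
    moreover have "(lam + 2) * real (M ^ i) \<le> real M * real (M ^ i)"
      using M(2) by (intro mult_right_mono) auto
    moreover have "1 \<le> real (M ^ i)" using M by simp
    ultimately show False using assms(5) by (simp add: distrib_right)
  qed
  then show ?thesis using assms by (auto simp: sparse_row_def)
qed

lemma exists_word_with_rows:
  assumes "\<And>t. 0 < fiber_count D (f t)"
  obtains w where "w \<in> words" "\<And>t. snd (w t) = f t"
proof -
  have "\<exists>i. (i, f t) \<in> D" for t using assms[of t] by (simp add: fiber_count_pos_iff)
  then obtain c where "\<And>t. (c t, f t) \<in> D" by metis
  then show ?thesis using that[of "\<lambda>t. (c t, f t)"] by (simp add: words_def)
qed

lemma exists_upper_index:
  assumes \<rho>: "0 < \<rho>" "\<rho> \<le> 1 / 27" and \<delta>: "0 \<le> \<delta>" "\<delta> \<le> delta_max n m D"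
  shows "\<exists>z\<in>carpet n m D. upper_index \<rho> z = ereal \<delta>"
proof -
  have lnm: "0 < ln (real m)" and lnn: "0 < ln (real n)" using m_ge_2 n_ge_2 by auto
  have lng: "0 < ln gain" using gain_gt_1 by simp
  \<comment> \<open>A run of length \<open>\<kappa> * l\<close> at a scale where
    \<open>- ln r\<close> is about \<open>l * ln m\<close> contributes
    \<open>\<kappa> * ln gain / ln m\<close> to the index; equating this with
    \<open>\<delta>\<close> gives \<open>\<kappa>\<close>.\<close>
  define \<kappa> where "\<kappa> = \<delta> * ln (real m) / ln gain"
  have \<kappa>0: "0 \<le> \<kappa>" using \<delta> lnm lng by (simp add: \<kappa>_def)
  have \<kappa>1: "\<kappa> \<le> 1 - ln (real m) / ln (real n)"
  proof -
    have "\<kappa> \<le> delta_max n m D * ln (real m) / ln gain"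
      unfolding \<kappa>_def using \<delta> lnm lng by (intro divide_right_mono mult_right_mono) auto
    also have "\<dots> = 1 - ln (real m) / ln (real n)"
      unfolding delta_max_eq using lnm lnn lng by (simp add: field_simps)
    finally show ?thesis .
  qed
  have \<sigma>: "0 < ln (real m) / ln (real n)" using lnm lnn by simp
  \<comment> \<open>A run from \<open>q\<close> to \<open>lam * q\<close> has relative length
    \<open>1 - 1 / lam\<close>, here equal to \<open>\<kappa>\<close>.\<close>
  define lam where "lam = 1 / (1 - \<kappa>)"
  have \<kappa>_less: "\<kappa> < 1" using \<kappa>1 \<sigma> by linarith
  have lam1: "1 \<le> lam" using \<kappa>0 \<kappa>_less by (simp add: lam_def)
  have lam_inv: "1 - 1 / lam = \<kappa>" using \<kappa>_less by (simp add: lam_def)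
  \<comment> \<open>This is \<open>\<delta> \<le> delta_max\<close> rewritten: such a run fits
    between the column scale and the row scale.\<close>
  have lam_le: "lam * ln (real m) \<le> ln (real n)"
  proof -
    have "ln (real m) / ln (real n) \<le> 1 - \<kappa>" using \<kappa>1 by linarith
    then have "ln (real m) \<le> (1 - \<kappa>) * ln (real n)" using lnn by (simp add: pos_divide_le_eq)
    then show ?thesis using \<kappa>_less by (simp add: lam_def pos_divide_le_eq mult.commute)
  qed
  obtain N :: nat where N: "lam \<le> real N" using real_arch_simple by blast
  define M where "M = 2 * N + 5"
  have M: "odd M" "5 \<le> M" "lam + 2 \<le> real M" using N by (auto simp: M_def)
  obtain j where j: "0 < fiber_count D j" "0 < fiber_count D (Suc j)" using adjacent_fibers by blast
  have "0 < fiber_count D (sparse_row M lam j t)" for t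
    using j fiber_top_pos fiber_less by (auto simp: sparse_row_def)
  then obtain w where w: "w \<in> words" and rows: "\<And>t. snd (w t) = sparse_row M lam j t"
    using exists_word_with_rows[of "sparse_row M lam j"] by blast
  have upper: "upper_index \<rho> (code w) \<le> ereal \<delta>"
  proof (rule upper_index_le[OF \<rho>(1) w])
    show "\<forall>\<^sub>F r in at_right 0. real (run_length (level n r) (level m r - 2) w) * ln gain \<le> \<delta> * (- ln r) + 8 * ln gain"
      using eventually_small_radius
    proof eventually_elim
      case (elim r)
      let ?p = "level m r - 2"
      let ?s = "run_length (level n r) ?p w"
      have "?s \<le> ?p" using run_length_le[of "level n r" ?p w] by linarith
      then have "real ?s \<le> \<kappa> * real ?p + 8"
        using sparse_row_boundary_run[OF M lam1 rows boundary_run_run_length[of w ?p "level n r"]]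
        by (simp add: lam_inv)
      also have "\<dots> \<le> \<kappa> * (- ln r / ln (real m)) + 8"
      proof -
        have "real ?p \<le> - ln r / ln (real m)" using level_bounds(1)[OF m_ge_2, of r] elim by linarith
        then show ?thesis using \<kappa>0 by (intro add_right_mono mult_left_mono)
      qed
      finally have "real ?s * ln gain \<le> (\<kappa> * (- ln r / ln (real m)) + 8) * ln gain"
        using lng by (intro mult_right_mono) auto
      also have "\<dots> = \<delta> * (- ln r) + 8 * ln gain"
        unfolding \<kappa>_def using lnm lng by (simp add: field_simps)
      finally show ?case .
    qed
  qed
  have lower: "ereal \<delta> \<le> upper_index \<rho> (code w)"
  \<comment> \<open>For \<open>\<delta> = 0\<close> the value of \<open>lam\<close> is 1 and the
    zero blocks are empty, so the bound comes from nonnegativity instead of a run.\<close>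
  proof (cases "\<delta> = 0")
    case True
    have "code w \<in> carpet n m D" using w by (simp add: carpet_eq)
    then have "0 \<le> lower_doubling_index (\<lambda>r. - ln r) (carpet n m D) bernoulli \<rho> (code w)"
      using \<rho> by (intro lower_index_nonneg) auto
    then show ?thesis
      using order_trans[OF _ lower_index_le_upper_index] True by (simp add: zero_ereal_def)
  next
    case False
    then have \<kappa>_pos: "0 < \<kappa>" using \<delta> lnm lng by (simp add: \<kappa>_def)
    then have lam_gt: "1 < lam" using \<kappa>_less by (simp add: lam_def)
    obtain C where C: "\<And>w q e. \<lbrakk>w \<in> words; 1 \<le> q; q < e; 3 \<le> e; snd (w (q - 1)) = Suc j; 0 < fiber_count D j;
        \<And>t. q \<le> t \<Longrightarrow> t < e \<Longrightarrow> snd (w t) = 0; 1 / real n ^ (q - 1) \<le> 1 / real m ^ e\<rbrakk> \<Longrightarrow>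
      ereal ((real (e - q) * ln gain - C) / - ln (4 / real m ^ e)) \<le> index_quotient \<rho> (code w) (4 / real m ^ e)"
      using quotient_lower[OF \<rho>] by metis
    define q where "q i = M ^ Suc i" for i
    \<comment> \<open>Scaling \<open>q i - 1\<close> instead of \<open>q i\<close> gives
      \<open>m ^ e i \<le> n ^ (q i - 1)\<close> without error, also at
      \<open>\<delta> = delta_max\<close>, where there is no slack.\<close>
    define e where "e i = nat \<lfloor>lam * (real (q i) - 1)\<rfloor>" for i
    have q1: "1 \<le> real (q i)" for i
    proof -
      have "1 \<le> q i" unfolding q_def using M(2) by (intro one_le_power) simp
      then show ?thesis by simp
    qed
    have e_le: "real (e i) \<le> lam * (real (q i) - 1)" and e_ge: "lam * (real (q i) - 1) - 1 \<le> real (e i)" for i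
    proof -
      have "0 \<le> lam * (real (q i) - 1)" using lam1 q1[of i] by simp
      then show "real (e i) \<le> lam * (real (q i) - 1)" "lam * (real (q i) - 1) - 1 \<le> real (e i)"
        unfolding e_def by linarith+
    qed
    have q_lim: "filterlim (\<lambda>i. real (q i)) at_top sequentially"
    proof -
      have "filterlim (\<lambda>i. real M ^ i) at_top sequentially"
        using M by (intro filterlim_at_infinity_imp_filterlim_at_top filterlim_realpow_sequentially_gt1) auto
      then have "filterlim (\<lambda>i. real M ^ Suc i) at_top sequentially"
        by (rule filterlim_compose[OF _ filterlim_Suc])
      then show ?thesis by (simp add: q_def)
    qed
    have inv_lim: "(\<lambda>i. c / real (q i)) \<longlonglongrightarrow> 0" for c
      using q_lim by (rule real_tendsto_divide_at_top[OF tendsto_const])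
    have ratio_lim: "(\<lambda>i. real (e i) / real (q i)) \<longlonglongrightarrow> lam"
    proof (rule tendsto_sandwich)
      show "\<forall>\<^sub>F i in sequentially. lam - (lam + 1) / real (q i) \<le> real (e i) / real (q i)"
      proof (intro always_eventually allI)
        fix i
        have "lam - (lam + 1) / real (q i) = (lam * (real (q i) - 1) - 1) / real (q i)"
          using q1[of i] by (simp add: field_simps)
        also have "\<dots> \<le> real (e i) / real (q i)"
          by (intro divide_right_mono e_ge) simp
        finally show "lam - (lam + 1) / real (q i) \<le> real (e i) / real (q i)" .
      qed
      show "\<forall>\<^sub>F i in sequentially. real (e i) / real (q i) \<le> lam"
      proof (intro always_eventually allI)
        fix i
        show "real (e i) / real (q i) \<le> lam"
          using e_le[of i] q1[of i] lam1 by (simp add: pos_divide_le_eq right_diff_distrib)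
      qed
      show "(\<lambda>i. lam - (lam + 1) / real (q i)) \<longlonglongrightarrow> lam"
        using tendsto_diff[OF tendsto_const inv_lim[of "lam + 1"], of lam] by simp
    qed simp
    have e_lim: "filterlim (\<lambda>i. real (e i)) at_top sequentially"
    proof -
      have "filterlim (\<lambda>i. real (e i) / real (q i) * real (q i)) at_top sequentially"
        using lam1 by (intro filterlim_tendsto_pos_mult_at_top[OF ratio_lim _ q_lim]) simp
      moreover have "real (e i) / real (q i) * real (q i) = real (e i)" for i using q1[of i] by simp
      ultimately show ?thesis by simp
    qed
    have ln_r: "- ln (4 / real m ^ e i) = real (e i) * ln (real m) - ln 4" for i
      using m_ge_2 by (simp add: ln_div ln_realpow)
    show ?thesis
      unfolding upper_doubling_index_def
    proof (rule le_Limsup_along_sequence)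
      show "filterlim (\<lambda>i. 4 / real m ^ e i) (at_right 0) sequentially"
      proof (rule tendsto_imp_filterlim_at_right)
        have "filterlim e at_top sequentially"
          using e_lim by (simp add: filterlim_sequentially_iff_filterlim_real)
        moreover have "(\<lambda>k. (1 / real m) ^ k) \<longlonglongrightarrow> 0"
          using m_ge_2 by (intro LIMSEQ_power_zero) auto
        ultimately have "(\<lambda>i. (1 / real m) ^ e i) \<longlonglongrightarrow> 0" by (rule filterlim_compose[rotated])
        from tendsto_mult[OF tendsto_const this, of 4]
        show "(\<lambda>i. 4 / real m ^ e i) \<longlonglongrightarrow> 0" by (simp add: power_divide)
      qed (use m_ge_2 in auto)
      \<comment> \<open>Numerator and denominator are divided by \<open>q i\<close>, so that only
        the ratio \<open>e i / q i\<close> and null sequences occur.\<close>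
      show "(\<lambda>i. ((real (e i) / real (q i) - 1) * ln gain - C / real (q i)) /
          (real (e i) / real (q i) * ln (real m) - ln 4 / real (q i))) \<longlonglongrightarrow> \<delta>"
      proof -
        have "(\<lambda>i. ((real (e i) / real (q i) - 1) * ln gain - C / real (q i)) /
            (real (e i) / real (q i) * ln (real m) - ln 4 / real (q i)))
          \<longlonglongrightarrow> ((lam - 1) * ln gain - 0) / (lam * ln (real m) - 0)"
          using lam1 lnm by (intro tendsto_intros ratio_lim inv_lim) auto
        moreover have "((lam - 1) * ln gain - 0) / (lam * ln (real m) - 0) = (1 - 1 / lam) * ln gain / ln (real m)"
          using lam1 lnm by (simp add: field_simps)
        moreover have "(1 - 1 / lam) * ln gain / ln (real m) = \<delta>"
          unfolding lam_inv \<kappa>_def using lnm lng by simp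
        ultimately show ?thesis by simp
      qed
      have "\<forall>\<^sub>F i in sequentially. 1 < real (e i) / real (q i)"
        using order_tendstoD(1)[OF ratio_lim lam_gt] .
      moreover have "\<forall>\<^sub>F i in sequentially. 3 \<le> real (e i)"
        using e_lim unfolding filterlim_at_top by blast
      ultimately show "\<forall>\<^sub>F i in sequentially. ereal (((real (e i) / real (q i) - 1) * ln gain - C / real (q i)) /
          (real (e i) / real (q i) * ln (real m) - ln 4 / real (q i))) \<le> index_quotient \<rho> (code w) (4 / real m ^ e i)"
      proof eventually_elim
        case (elim i)
        have qe: "q i < e i" using elim(1) q1[of i] by (simp add: pos_less_divide_eq)
        have "ereal ((real (e i - q i) * ln gain - C) / - ln (4 / real m ^ e i)) \<le> index_quotient \<rho> (code w) (4 / real m ^ e i)"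
        proof (rule C[OF w _ qe])
          show "1 \<le> q i" "3 \<le> e i" using q1[of i] elim by auto
          have "Suc (q i - 1) = M ^ Suc i" using M by (simp add: q_def)
          then show "snd (w (q i - 1)) = Suc j" unfolding rows sparse_row_def by (metis le_add1 plus_1_eq_Suc)
          show "snd (w t) = 0" if "q i \<le> t" "t < e i" for t
            unfolding rows
          proof (rule sparse_row_zeros[OF M(2,3), of "Suc i"])
            have "real t < lam * (real (q i) - 1)" using that(2) e_le[of i] by linarith
            also have "\<dots> \<le> lam * real (q i)" using lam1 by (intro mult_left_mono) auto
            finally show "real t < lam * real (M ^ Suc i)" by (simp add: q_def)
          qed (use that in \<open>auto simp: q_def\<close>)
          have "real (e i) * ln (real m) \<le> lam * (real (q i) - 1) * ln (real m)"
            using e_le lnm by (intro mult_right_mono) auto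
          also have "\<dots> \<le> (real (q i) - 1) * ln (real n)"
            using mult_left_mono[OF lam_le, of "real (q i) - 1"] q1[of i] by (simp add: mult_ac)
          finally have "ln (real m ^ e i) \<le> ln (real n ^ (q i - 1))"
            using m_ge_2 n_ge_2 q1[of i] by (simp add: ln_realpow of_nat_diff)
          then have "real m ^ e i \<le> real n ^ (q i - 1)" using m_ge_2 n_ge_2 by simp
          then show "1 / real n ^ (q i - 1) \<le> 1 / real m ^ e i"
            using m_ge_2 n_ge_2 by (intro divide_left_mono mult_pos_pos) auto
        qed (use j in auto)
        moreover have "(real (e i - q i) * ln gain - C) / - ln (4 / real m ^ e i)
            = ((real (e i) / real (q i) - 1) * ln gain - C / real (q i)) /
              (real (e i) / real (q i) * ln (real m) - ln 4 / real (q i))"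
        proof -
          have "(real (e i) / real (q i) - 1) * ln gain - C / real (q i) = (real (e i - q i) * ln gain - C) / real (q i)"
            using qe q1[of i] by (simp add: of_nat_diff field_simps)
          moreover have "real (e i) / real (q i) * ln (real m) - ln 4 / real (q i) = - ln (4 / real m ^ e i) / real (q i)"
            unfolding ln_r by (simp add: diff_divide_distrib)
          ultimately show ?thesis using q1[of i] by simp
        qed
        ultimately show ?case by simp
      qed
    qed
  qed
  show ?thesis
    using antisym[OF upper lower] w by (intro bexI[of _ "code w"]) (auto simp: carpet_eq)
qed

lemma upper_index_range:
  assumes "0 < \<rho>" "\<rho> \<le> 1 / 27"
  shows "upper_index \<rho> ` carpet n m D = ereal ` {0..delta_max n m D}"
proof (intro equalityI subsetI)
  fix x assume "x \<in> upper_index \<rho> ` carpet n m D"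
  then obtain z where z: "z \<in> carpet n m D" "x = upper_index \<rho> z" by auto
  then obtain w where "w \<in> words" "z = code w" by (auto simp: carpet_eq)
  then have "x \<le> ereal (delta_max n m D)" using z upper_index_le_delta_max assms by simp
  moreover have "0 \<le> x"
    unfolding z(2) using assms z(1) by (intro order_trans[OF lower_index_nonneg lower_index_le_upper_index]) auto
  ultimately show "x \<in> ereal ` {0..delta_max n m D}" by (cases x) auto
next
  fix x assume "x \<in> ereal ` {0..delta_max n m D}"
  then show "x \<in> upper_index \<rho> ` carpet n m D"
    using exists_upper_index[OF assms] by force
qed

end

theorem theorem5p1:
  fixes n m :: nat and D :: "(nat \<times> nat) set" and \<rho> :: real
  assumes "2 \<le> m" and "m < n"
    and "D \<subseteq> {0..<n} \<times> {0..<m}" and "D \<noteq> {}"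
    and "non_doubling_type n m D"
    and "fiber_count D 0 > fiber_count D (m - 1)"
    and "0 < \<rho>" and "\<rho> < 1 / real n ^ 3"
  defines "E \<equiv> carpet n m D" and "\<mu> \<equiv> carpet_measure n m D" and "\<phi> \<equiv> \<lambda>r::real. - ln r"
  shows "(AE z in \<mu>. z \<in> E \<longrightarrow> has_doubling_index \<phi> E \<mu> \<rho> z 0) \<and>
         (\<lambda>z. upper_doubling_index \<phi> E \<mu> \<rho> z) ` E = ereal ` {0..delta_max n m D}"
proof -
  interpret asymmetric_mcmullen n m D by unfold_locales (use assms in auto)
  have "0 < fiber_count D (m - 1) \<and> (\<exists>j. 0 < fiber_count D j \<and> 0 < fiber_count D (Suc j))"
    using doubling_without_carries assms(5) unfolding non_doubling_type_def carpet_measure_eq by blast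
  then interpret nondoubling_mcmullen n m D by unfold_locales auto
  \<comment> \<open>From \<open>n > m \<ge> 2\<close> follows \<open>n \<ge> 3\<close>, the source
    of the bound \<open>1 / 27\<close>.\<close>
  have "1 / real n ^ 3 \<le> 1 / 3 ^ 3"
    using assms(1,2) by (intro divide_left_mono power_mono) auto
  then have "\<rho> \<le> 1 / 27" "\<rho> < 1" using assms(8) by auto
  then show ?thesis
    unfolding E_def \<mu>_def \<phi>_def carpet_measure_eq
    using AE_has_doubling_index_zero upper_index_range assms(7) by blast
qed

end
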